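(* Let $\mathfrak g=\mathfrak{so}_n$ with $n\ge7$. For $k\ge2$ we have $\mathsf m(\Phi_{2k})=R(k)\,\Phi_{2k-2}$, where $$R(k)=\frac1{k(2k-1)}\left(\binom n2+2n(k-1)+(k-1)(2k-3)\right).$$
   Context: $\mathfrak{so}_n\subset\mathfrak{gl}_n$ is the linear span of $F_{ij}=E_{ij}-E_{j'i'}$, $i,j\in\{1,\dots,n\}$, $i'=n-i+1$. The invariants $\Phi_{2k}\in\mathcal S^{2k}(\mathfrak g)^{\mathfrak g}$ are defined by $\det(I_n-q(F_{ij}))^{-1}=1+\Phi_2q^2+\Phi_4q^4+\dots+\Phi_{2k}q^{2k}+\cdots$, the determinant being computed over the commutative algebra $\mathcal S(\mathfrak g)$. The map $\mathsf m$: embed $\mathcal S^m(\mathfrak g)$ in $\mathfrak g^{\otimes m}$ via the symmetrisation $\varpi(y_1\cdots y_m)=\frac1{m!}\sum_{\sigma\in S_m}y_{\sigma(1)}\otimes\dots\otimes y_{\sigma(m)}$. For $m\ge3$, $\mathsf m:\mathcal S^m(\mathfrak g)\to\mathfrak{so}(\mathfrak g)\otimes\mathcal S^{m-3}(\mathfrak g)\cong\Lambda^2\mathfrak g\otimes\mathcal S^{m-3}(\mathfrak g)$ is the restriction of $y_1\otimes\dots\otimes y_m\mapsto\operatorname{ad}(y_1)\operatorname{ad}(y_2)\operatorname{ad}(y_3)\otimes y_4\otimes\dots\otimes y_m$. One regards $\mathfrak g\subset\mathfrak{so}(\mathfrak g)$ via $\operatorname{ad}$, and $\mathcal S^{m-2}(\mathfrak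 g)\subset\mathfrak g\otimes\mathcal S^{m-3}(\mathfrak g)\subset\mathfrak{so}(\mathfrak g)\otimes\mathcal S^{m-3}(\mathfrak g)$ via $\varpi$; i.e. $y_1\cdots y_{m-2}$ corresponds to $\frac1{m-2}\sum_jy_j\otimes\prod_{i\ne j}y_i$. The displayed equality is understood in this sense. *)

theory Defs
  imports
    "HOL-Library.Poly_Mapping"
    "HOL-Library.Multiset"
    "HOL-Combinatorics.Permutations"
    "HOL-Computational_Algebra.Formal_Power_Series"
    "Jordan_Normal_Form.Determinant"
begin

text \<open>Matrix indices run over \<open>0,\<dots>,n-1\<close>, so the involution \<open>i' = n-i+1\<close> of
  \<open>{1,\<dots>,n}\<close> becomes \<open>i' = n-1-i\<close>.\<close>

definition opp :: "nat \<Rightarrow> nat \<Rightarrow> nat"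
  where "opp n i = n - 1 - i"

definition E_mat :: "nat \<Rightarrow> nat \<Rightarrow> nat \<Rightarrow> 'a::ring_1 mat"
  where "E_mat n i j = mat n n (\<lambda>rc. if rc = (i, j) then 1 else 0)"

definition F_mat :: "nat \<Rightarrow> nat \<times> nat \<Rightarrow> 'a::ring_1 mat"
  where "F_mat n = (\<lambda>(i, j). E_mat n i j - E_mat n (opp n j) (opp n i))"

definition so_n :: "nat \<Rightarrow> 'a::ring_1 mat set"
  where "so_n n = {mat n n (\<lambda>rc. \<Sum>p\<in>{..<n} \<times> {..<n}. c p * F_mat n p $$ rc) | c. True}"

text \<open>Since \<open>F\<^sub>i\<^sub>j = -F\<^sub>j\<^sub>'\<^sub>i\<^sub>'\<close>, the \<open>F\<^sub>i\<^sub>j\<close> with \<open>i < j'\<close> form a basis of \<open>\<ss>\<oo>\<^sub>n\<close>;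
  the coordinate of \<open>A \<in> \<ss>\<oo>\<^sub>n\<close> at \<open>F\<^sub>i\<^sub>j\<close> is the matrix entry \<open>A\<^sub>i\<^sub>j\<close>
  (lemmas \<open>F_mat_dual\<close> and \<open>so_n_expand\<close> below).\<close>

definition so_idx :: "nat \<Rightarrow> (nat \<times> nat) set"
  where "so_idx n = {(i, j). j < n \<and> i < opp n j}"

definition ad :: "'a::ring_1 mat \<Rightarrow> 'a mat \<Rightarrow> 'a mat"
  where "ad A B = A * B - B * A"

text \<open>With \<open>b\<close> ranging over \<open>so_idx n\<close>, monomials in the basis \<open>F\<^sub>b\<close> are multisets of indices and
  decomposable basis tensors are words of indices. So \<open>S(\<gg>)\<close> is the monoid algebra of the
  multisets (with its convolution product), and the tensor space \<open>T(\<gg>)\<close> is the vector space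
  with basis the words.\<close>

type_synonym 'a sym_alg = "(nat \<times> nat) multiset \<Rightarrow>\<^sub>0 'a"
type_synonym 'a tensors = "(nat \<times> nat) list \<Rightarrow>\<^sub>0 'a"

definition sym_of :: "nat \<Rightarrow> 'a::ring_1 mat \<Rightarrow> 'a sym_alg"
  where "sym_of n A = (\<Sum>b\<in>so_idx n. Poly_Mapping.single {#b#} (A $$ b))"

definition sym_const :: "'a::ring_1 \<Rightarrow> 'a sym_alg"
  where "sym_const c = Poly_Mapping.single {#} c"

text \<open>\<open>Phi n d\<close> is the coefficient of \<open>q^d\<close> in \<open>det(I\<^sub>n - q(F\<^sub>i\<^sub>j))^{-1}\<close>. The constant term of the
  determinant is \<open>1\<close>, hence the second argument of \<^const>\<open>fps_right_inverse\<close>.\<close>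

definition F_gen :: "nat \<Rightarrow> 'a::comm_ring_1 sym_alg mat"
  where "F_gen n = mat n n (\<lambda>p. sym_of n (F_mat n p))"

definition Phi_det :: "nat \<Rightarrow> 'a::comm_ring_1 sym_alg fps"
  where "Phi_det n = det (1\<^sub>m n - fps_X \<cdot>\<^sub>m map_mat fps_const (F_gen n))"

definition Phi :: "nat \<Rightarrow> nat \<Rightarrow> 'a::comm_ring_1 sym_alg"
  where "Phi n d = fps_nth (fps_right_inverse (Phi_det n) 1) d"

text \<open>The symmetrisation \<open>\<varpi>\<close>; \<open>symm_word c [y\<^sub>1,\<dots>,y\<^sub>m] = \<varpi>(c y\<^sub>1\<cdots>y\<^sub>m)\<close>. The value on a monomial does not depend on the enumeration \<open>ys\<close>
  of its factors (lemma \<open>symm_word_perm\<close>).\<close>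

definition symm_word :: "'a::field_char_0 \<Rightarrow> (nat \<times> nat) list \<Rightarrow> 'a tensors"
  where "symm_word c ys =
    (\<Sum>\<sigma> | \<sigma> permutes {..<length ys}.
       Poly_Mapping.single (permute_list \<sigma> ys) (c / fact (length ys)))"

definition symm :: "'a::field_char_0 sym_alg \<Rightarrow> 'a tensors"
  where "symm s = (\<Sum>M\<in>Poly_Mapping.keys s.
     symm_word (Poly_Mapping.lookup s M) (SOME ys. mset ys = M))"

definition ten_prod :: "'a::ring_1 tensors \<Rightarrow> 'a sym_alg"
  where "ten_prod t = (\<Sum>w\<in>Poly_Mapping.keys t.
     Poly_Mapping.single (mset w) (Poly_Mapping.lookup t w))"

text \<open>The spaces \<open>\<ss>\<oo>(\<gg>) \<otimes> V \<subseteq> \<gg>\<ll>(\<gg>) \<otimes> V\<close> are not distinguished: equality in the former is equality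
  in the latter. An element of \<open>\<gg>\<ll>(\<gg>) \<otimes> V\<close> is represented by its matrix, with entries in \<open>V\<close>, with respect
  to the basis \<open>(F\<^sub>b)\<close>; entries outside \<open>so_idx n\<close> are \<open>0\<close>. \<open>op_coeff n T a b\<close> is the \<open>(a, b)\<close>
  entry of an endomorphism \<open>T\<close> of \<open>\<gg>\<close>.\<close>

definition op_coeff :: "nat \<Rightarrow> ('a::ring_1 mat \<Rightarrow> 'a mat) \<Rightarrow> nat \<times> nat \<Rightarrow> nat \<times> nat \<Rightarrow> 'a"
  where "op_coeff n T a b = (if a \<in> so_idx n \<and> b \<in> so_idx n then T (F_mat n b) $$ a else 0)"

text \<open>The map \<open>y\<^sub>1 \<otimes> \<dots> \<otimes> y\<^sub>m \<mapsto> ad(y\<^sub>1) ad(y\<^sub>2) ad(y\<^sub>3) \<otimes> y\<^sub>4 \<otimes> \<dots> \<otimes> y\<^sub>m\<close>, meant for \<open>m \<ge> 3\<close>.\<close>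

definition m_tensor ::
  "nat \<Rightarrow> 'a::ring_1 tensors \<Rightarrow> nat \<times> nat \<Rightarrow> nat \<times> nat \<Rightarrow> 'a tensors"
  where "m_tensor n t = (\<lambda>a b. \<Sum>w\<in>Poly_Mapping.keys t.
     Poly_Mapping.single (drop 3 w) (Poly_Mapping.lookup t w *
       op_coeff n (ad (F_mat n (w ! 0)) \<circ> ad (F_mat n (w ! 1)) \<circ> ad (F_mat n (w ! 2))) a b))"

text \<open>On symmetric tensors \<open>m_tensor\<close> takes values in \<open>\<gg>\<ll>(\<gg>) \<otimes> \<varpi>(S(\<gg>))\<close>, and multiplying out the
  remaining factors is inverse to \<open>\<varpi>\<close> there (lemmas \<open>ten_prod_symm\<close> and \<open>symm_m_map\<close>).\<close>

definition m_map ::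
  "nat \<Rightarrow> 'a::field_char_0 sym_alg \<Rightarrow> nat \<times> nat \<Rightarrow> nat \<times> nat \<Rightarrow> 'a sym_alg"
  where "m_map n s = (\<lambda>a b. ten_prod (m_tensor n (symm s) a b))"

text \<open>The inclusion \<open>S(\<gg>) \<rightarrow> \<gg>\<ll>(\<gg>) \<otimes> S(\<gg>)\<close>,
  \<open>y\<^sub>1 \<cdots> y\<^sub>d \<mapsto> 1/d \<Sum>\<^sub>j ad(y\<^sub>j) \<otimes> \<Prod>\<^sub>i\<^sub>\<noteq>\<^sub>j y\<^sub>i\<close>.\<close>

definition ad_incl ::
  "nat \<Rightarrow> 'a::field_char_0 sym_alg \<Rightarrow> nat \<times> nat \<Rightarrow> nat \<times> nat \<Rightarrow> 'a sym_alg"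
  where "ad_incl n s = (\<lambda>a b. \<Sum>M\<in>Poly_Mapping.keys s.
     \<Sum>y\<in>#M. Poly_Mapping.single (M - {#y#})
       (Poly_Mapping.lookup s M / of_nat (size M) * op_coeff n (ad (F_mat n y)) a b))"

definition R_const :: "nat \<Rightarrow> nat \<Rightarrow> 'a::field_char_0"
  where "R_const n k = 1 / (of_nat k * (2 * of_nat k - 1)) *
     (of_nat (n choose 2) + 2 * of_nat n * (of_nat k - 1)
       + (of_nat k - 1) * (2 * of_nat k - 3))"


subsection \<open>The basis of \<open>\<ss>\<oo>\<^sub>n\<close>\<close>

lemma so_idx_bounds: "(i, j) \<in> so_idx n \<Longrightarrow> i < n \<and> j < n"
  by (auto simp: so_idx_def opp_def)

lemma finite_so_idx [simp]: "finite (so_idx n)"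
  by (rule finite_subset[of _ "{..<n} \<times> {..<n}"]) (auto dest: so_idx_bounds)

lemma opp_less: "i < n \<Longrightarrow> opp n i < n"
  by (simp add: opp_def)

lemma opp_opp: "i < n \<Longrightarrow> opp n (opp n i) = i"
  by (simp add: opp_def)

lemma F_mat_carrier [simp]: "F_mat n p \<in> carrier_mat n n"
  by (cases p) (auto simp: F_mat_def E_mat_def intro!: minus_carrier_mat)

lemma F_mat_entry:
  assumes "i < n" "j < n" "r < n" "c < n"
  shows "F_mat n (i, j) $$ (r, c) =
    (if (r, c) = (i, j) then 1 else 0) - (if (r, c) = (opp n j, opp n i) then 1 else 0)"
  using assms by (simp add: F_mat_def E_mat_def)

lemma F_mat_skew:
  assumes "k < n" "l < n" "i < n" "j < n"
  shows "F_mat n (k, l) $$ (i, j) = - F_mat n (k, l) $$ (opp n j, opp n i)"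
proof -
  have "(opp n j, opp n i) = (k, l) \<longleftrightarrow> (i, j) = (opp n l, opp n k)"
    "(opp n j, opp n i) = (opp n l, opp n k) \<longleftrightarrow> (i, j) = (k, l)"
    using assms by (auto simp: opp_def)
  then show ?thesis
    using assms by (simp only: F_mat_entry opp_less) simp
qed

lemma F_mat_dual:
  assumes "a \<in> so_idx n" "b \<in> so_idx n"
  shows "F_mat n b $$ a = (if a = b then 1 else 0)"
proof -
  obtain r c i j where ab: "a = (r, c)" "b = (i, j)" by (cases a, cases b)
  have "(r, c) \<noteq> (opp n j, opp n i)"
    using assms unfolding ab so_idx_def opp_def by auto
  then show ?thesis
    using assms[unfolded ab] so_idx_bounds[of r c n] so_idx_bounds[of i j n]
    by (auto simp: ab F_mat_entry)
qed

lemma F_mat_coeff: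
  assumes "b \<in> {..<n} \<times> {..<n}" and rc: "r < n" "c < n"
  shows "x * F_mat n b $$ (r, c) =
    (if b = (r, c) then x else 0) - (if b = (opp n c, opp n r) then x else 0)"
proof -
  from assms(1) obtain i j where b: "b = (i, j)" "i < n" "j < n" by auto
  have 2: "(r, c) = (opp n j, opp n i) \<longleftrightarrow> b = (opp n c, opp n r)"
    using b rc by (auto simp: opp_opp opp_less)
  have eq: "F_mat n b $$ (r, c) =
      (if b = (r, c) then 1 else 0) - (if b = (opp n c, opp n r) then 1 else (0 :: 'a))"
    using F_mat_entry[OF b(2,3) rc, where 'a = 'a]
    unfolding 2 b(1)[symmetric] unfolding eq_commute[of "(r, c)" b] .
  have "x * ((if P then 1 else 0) - (if Q then 1 else 0)) =
      (if P then x else 0) - (if Q then x else 0)" for P Q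
    by (simp add: right_diff_distrib)
  then show ?thesis unfolding eq .
qed

lemma so_n_iff:
  fixes A :: "'a::field_char_0 mat"
  shows "A \<in> so_n n \<longleftrightarrow>
    A \<in> carrier_mat n n \<and> (\<forall>i<n. \<forall>j<n. A $$ (i, j) = - A $$ (opp n j, opp n i))"
proof
  assume "A \<in> so_n n"
  then obtain c where A: "A = mat n n (\<lambda>rc. \<Sum>p\<in>{..<n} \<times> {..<n}. c p * F_mat n p $$ rc)"
    by (auto simp: so_n_def)
  have "A $$ (i, j) = - A $$ (opp n j, opp n i)" if "i < n" "j < n" for i j
  proof -
    have "A $$ (i, j) = (\<Sum>p\<in>{..<n} \<times> {..<n}. c p * F_mat n p $$ (i, j))"
      using that by (simp add: A)
    also have "\<dots> = (\<Sum>p\<in>{..<n} \<times> {..<n}. - (c p * F_mat n p $$ (opp n j, opp n i)))"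
      by (rule sum.cong[OF refl]) (use that F_mat_skew[where 'a = 'a] in fastforce)
    also have "\<dots> = - A $$ (opp n j, opp n i)"
      using that by (simp add: A sum_negf opp_less)
    finally show ?thesis .
  qed
  then show "A \<in> carrier_mat n n \<and> (\<forall>i<n. \<forall>j<n. A $$ (i, j) = - A $$ (opp n j, opp n i))"
    by (simp add: A)
next
  assume A: "A \<in> carrier_mat n n \<and> (\<forall>i<n. \<forall>j<n. A $$ (i, j) = - A $$ (opp n j, opp n i))"
  have "A = mat n n (\<lambda>rc. \<Sum>p\<in>{..<n} \<times> {..<n}. (A $$ p / 2) * F_mat n p $$ rc)"
    (is "A = ?B")
  proof (rule eq_matI)
    fix r c assume "r < dim_row ?B" "c < dim_col ?B"
    then have rc: "r < n" "c < n" by auto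
    have "(\<Sum>p\<in>{..<n} \<times> {..<n}. (A $$ p / 2) * F_mat n p $$ (r, c)) =
        (\<Sum>p\<in>{..<n} \<times> {..<n}. (if p = (r, c) then A $$ p / 2 else 0)
          - (if p = (opp n c, opp n r) then A $$ p / 2 else 0))"
      by (rule sum.cong[OF refl], rule F_mat_coeff[OF _ rc])
    then have "?B $$ (r, c) = A $$ (r, c) / 2 - A $$ (opp n c, opp n r) / 2"
      using rc by (simp add: sum_subtractf opp_less)
    also have "\<dots> = A $$ (r, c)"
    proof -
      have "A $$ (opp n c, opp n r) = - A $$ (r, c)"
        using A rc minus_minus[of "A $$ (opp n c, opp n r)"] by metis
      then show ?thesis by simp
    qed
    finally show "A $$ (r, c) = ?B $$ (r, c)" by simp
  qed (use A in auto)
  then have "\<exists>c. A = mat n n (\<lambda>rc. \<Sum>p\<in>{..<n} \<times> {..<n}. c p * F_mat n p $$ rc)"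
    by (rule exI[of "\<lambda>c. A = mat n n (\<lambda>rc. \<Sum>p\<in>{..<n} \<times> {..<n}. c p * F_mat n p $$ rc)"
        "\<lambda>p. A $$ p / 2"])
  then show "A \<in> so_n n"
    by (simp only: so_n_def mem_Collect_eq simp_thms)
qed

lemma F_mat_in_so_n:
  assumes "i < n" "j < n"
  shows "(F_mat n (i, j) :: 'a::field_char_0 mat) \<in> so_n n"
  unfolding so_n_iff by (intro conjI allI impI F_mat_carrier F_mat_skew[OF assms])

lemma so_n_expand:
  fixes A :: "'a::field_char_0 mat"
  assumes "A \<in> so_n n"
  shows "A = mat n n (\<lambda>rc. \<Sum>b\<in>so_idx n. A $$ b * F_mat n b $$ rc)" (is "A = ?B")
proof (rule eq_matI)
  have A: "A \<in> carrier_mat n n" "\<And>i j. i < n \<Longrightarrow> j < n \<Longrightarrow> A $$ (i, j) = - A $$ (opp n j, opp n i)"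
    using assms by (auto simp: so_n_iff)
  fix r c assume "r < dim_row ?B" "c < dim_col ?B"
  then have rc: "r < n" "c < n" by auto
  have "(\<Sum>b\<in>so_idx n. A $$ b * F_mat n b $$ (r, c)) =
      (\<Sum>b\<in>so_idx n. (if b = (r, c) then A $$ b else 0)
        - (if b = (opp n c, opp n r) then A $$ b else 0))"
    by (rule sum.cong[OF refl], rule F_mat_coeff[OF _ rc]) (auto dest: so_idx_bounds)
  then have B: "?B $$ (r, c) = (if (r, c) \<in> so_idx n then A $$ (r, c) else 0)
      - (if (opp n c, opp n r) \<in> so_idx n then A $$ (opp n c, opp n r) else 0)"
    using rc by (simp add: sum_subtractf)
  consider "r < opp n c" | "r = opp n c" | "r > opp n c" by linarith
  then show "A $$ (r, c) = ?B $$ (r, c)"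
  proof cases
    case 1
    then have "(r, c) \<in> so_idx n" "(opp n c, opp n r) \<notin> so_idx n"
      using rc by (auto simp: so_idx_def opp_def)
    then show ?thesis using B by simp
  next
    case 2
    then have "(r, c) \<notin> so_idx n" "(opp n c, opp n r) \<notin> so_idx n"
      using rc by (auto simp: so_idx_def opp_def)
    moreover have "A $$ (r, c) = 0"
      using A(2)[OF rc] 2 rc by (simp add: opp_opp equal_neg_zero)
    ultimately show ?thesis using B by simp
  next
    case 3
    then have "(r, c) \<notin> so_idx n" "(opp n c, opp n r) \<in> so_idx n"
      using rc by (auto simp: so_idx_def opp_def)
    then show ?thesis using B A(2)[OF rc] by simp
  qed
qed (use assms in \<open>auto simp: so_n_iff\<close>)

lemma ad_in_so_n:
  fixes A B :: "'a::field_char_0 mat"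
  assumes "A \<in> so_n n" "B \<in> so_n n"
  shows "ad A B \<in> so_n n"
proof -
  have A: "A \<in> carrier_mat n n" "\<And>i j. i < n \<Longrightarrow> j < n \<Longrightarrow> A $$ (i, j) = - A $$ (opp n j, opp n i)"
    using assms by (auto simp: so_n_iff)
  have B: "B \<in> carrier_mat n n" "\<And>i j. i < n \<Longrightarrow> j < n \<Longrightarrow> B $$ (i, j) = - B $$ (opp n j, opp n i)"
    using assms by (auto simp: so_n_iff)
  have bij: "bij_betw (opp n) {0..<n} {0..<n}"
    by (rule bij_betwI[where g = "opp n"]) (auto simp: opp_less opp_opp)
  have prod: "(X * Y) $$ (i, j) = (\<Sum>l\<in>{0..<n}. X $$ (i, l) * Y $$ (l, j))"
    if "X \<in> carrier_mat n n" "Y \<in> carrier_mat n n" "i < n" "j < n" for X Y :: "'a mat" and i j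
    using that by (auto simp: scalar_prod_def)
  have swap: "(X * Y) $$ (i, j) = (Y * X) $$ (opp n j, opp n i)"
    if X: "X \<in> carrier_mat n n" "\<And>i j. i < n \<Longrightarrow> j < n \<Longrightarrow> X $$ (i, j) = - X $$ (opp n j, opp n i)"
      and Y: "Y \<in> carrier_mat n n" "\<And>i j. i < n \<Longrightarrow> j < n \<Longrightarrow> Y $$ (i, j) = - Y $$ (opp n j, opp n i)"
      and ij: "i < n" "j < n" for X Y :: "'a mat" and i j
  proof -
    have "(X * Y) $$ (i, j) = (\<Sum>l\<in>{0..<n}. X $$ (i, l) * Y $$ (l, j))"
      by (rule prod[OF X(1) Y(1) ij])
    also have "\<dots> = (\<Sum>l\<in>{0..<n}. Y $$ (opp n j, opp n l) * X $$ (opp n l, opp n i))"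
    proof (rule sum.cong[OF refl])
      fix l assume "l \<in> {0..<n}"
      then show "X $$ (i, l) * Y $$ (l, j) = Y $$ (opp n j, opp n l) * X $$ (opp n l, opp n i)"
        using X(2)[of i l] Y(2)[of l j] ij by simp
    qed
    also have "\<dots> = (\<Sum>l\<in>{0..<n}. Y $$ (opp n j, l) * X $$ (l, opp n i))"
      by (rule sum.reindex_bij_betw[OF bij])
    also have "\<dots> = (Y * X) $$ (opp n j, opp n i)"
      by (rule prod[OF Y(1) X(1) opp_less[OF ij(2)] opp_less[OF ij(1)], symmetric])
    finally show ?thesis .
  qed
  have "ad A B $$ (i, j) = - ad A B $$ (opp n j, opp n i)" if "i < n" "j < n" for i j
    using swap[OF A B that] swap[OF B A that] A(1) B(1) that opp_less
    by (simp add: ad_def del: index_mult_mat(1))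
  moreover have "ad A B \<in> carrier_mat n n"
    using A(1) B(1) unfolding ad_def by (intro minus_carrier_mat mult_carrier_mat)
  ultimately show ?thesis by (auto simp: so_n_iff)
qed


subsection \<open>The generating function of the invariants\<close>

lemma Phi_det_0: "fps_nth (Phi_det n) 0 = (1 :: 'a::comm_ring_1 sym_alg)"
proof -
  interpret comm_ring_hom "\<lambda>f :: 'a sym_alg fps. fps_nth f 0"
    by unfold_locales auto
  let ?A = "1\<^sub>m n - fps_X \<cdot>\<^sub>m map_mat fps_const (F_gen n) :: 'a sym_alg fps mat"
  have "map_mat (\<lambda>f. fps_nth f 0) ?A = 1\<^sub>m n"
    by (rule eq_matI) (auto simp: F_gen_def one_mat_def)
  then have "det (1\<^sub>m n :: 'a sym_alg mat) = fps_nth (det ?A) 0"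
    by (metis hom_det)
  then show ?thesis by (simp add: Phi_det_def)
qed

lemma Phi_gen: "Phi_det n * Abs_fps (Phi n) = (1 :: 'a::comm_ring_1 sym_alg fps)"
proof -
  have "Abs_fps (Phi n) = fps_right_inverse (Phi_det n) (1 :: 'a sym_alg)"
    by (rule fps_ext) (simp add: Phi_def)
  then show ?thesis using fps_right_inverse[of "Phi_det n" "1 :: 'a sym_alg"] by (simp add: Phi_det_0)
qed


subsection \<open>Symmetrisation\<close>

lemma symm_word_perm:
  assumes "mset xs = mset ys"
  shows "symm_word c xs = symm_word c ys"
proof -
  obtain p where p: "p permutes {..<length ys}" "permute_list p ys = xs"
    using mset_eq_permutation[OF assms] .
  have len: "length xs = length ys" using assms by (rule mset_eq_length)
  have "symm_word c xs = (\<Sum>\<sigma> | \<sigma> permutes {..<length ys}.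
      Poly_Mapping.single (permute_list (p \<circ> \<sigma>) ys) (c / fact (length ys)))"
    unfolding symm_word_def len
    by (rule sum.cong) (auto simp: p(2)[symmetric] permute_list_compose)
  also have "\<dots> = symm_word c ys"
    unfolding symm_word_def
    using setum_permutations_compose_left[OF p(1),
        of "\<lambda>\<sigma>. Poly_Mapping.single (permute_list \<sigma> ys) (c / fact (length ys))"]
    by simp
  finally show ?thesis .
qed

lemma symm_word_some: "symm_word c (SOME ys. mset ys = mset w) = symm_word c w"
  by (rule symm_word_perm, rule someI[of "\<lambda>ys. mset ys = mset w"]) simp

lemma symm_word_0 [simp]: "symm_word 0 ys = 0"
  by (simp add: symm_word_def)

lemma symm_word_add: "symm_word (c + d) ys = symm_word c ys + symm_word d ys"
  by (simp add: symm_word_def add_divide_distrib single_add sum.distrib)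

lemma sum_keys_single:
  assumes "\<And>k. f k 0 = 0"
  shows "(\<Sum>k\<in>Poly_Mapping.keys (Poly_Mapping.single k0 c).
    f k (Poly_Mapping.lookup (Poly_Mapping.single k0 c) k)) = f k0 c"
  using assms by (cases "c = 0") auto

lemma symm_add: "symm (s + t) = symm s + symm t"
  unfolding symm_def by (rule setsum_keys_plus_distrib) (auto simp: symm_word_add)

lemma symm_sum: "symm (sum g A) = (\<Sum>x\<in>A. symm (g x))"
  by (induction A rule: infinite_finite_induct) (auto simp: symm_add, simp_all add: symm_def)

lemma symm_single: "symm (Poly_Mapping.single (mset w) c) = symm_word c w"
  unfolding symm_def
  by (subst sum_keys_single[where f = "\<lambda>M c. symm_word c (SOME ys. mset ys = M)"])
     (auto simp: symm_word_some)

lemma ten_prod_add: "ten_prod (s + t) = ten_prod s + ten_prod t"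
  unfolding ten_prod_def by (rule setsum_keys_plus_distrib) (auto simp: single_add)

lemma ten_prod_sum: "ten_prod (sum g A) = (\<Sum>x\<in>A. ten_prod (g x))"
  by (induction A rule: infinite_finite_induct) (auto simp: ten_prod_add, simp_all add: ten_prod_def)

lemma ten_prod_single: "ten_prod (Poly_Mapping.single w c) = Poly_Mapping.single (mset w) c"
  unfolding ten_prod_def
  by (rule sum_keys_single[where f = "\<lambda>w c. Poly_Mapping.single (mset w) c"]) simp

lemma m_tensor_add: "m_tensor n (s + t) a b = m_tensor n s a b + m_tensor n t a b"
  unfolding m_tensor_def by (rule setsum_keys_plus_distrib) (auto simp: single_add ring_distribs)

lemma m_tensor_sum: "m_tensor n (sum g A) a b = (\<Sum>x\<in>A. m_tensor n (g x) a b)"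
  by (induction A rule: infinite_finite_induct)
     (auto simp: m_tensor_add, simp_all add: m_tensor_def)

definition m_word :: "nat \<Rightarrow> (nat \<times> nat) list \<Rightarrow> nat \<times> nat \<Rightarrow> nat \<times> nat \<Rightarrow> 'a::ring_1"
  where "m_word n w = op_coeff n
     (ad (F_mat n (w ! 0)) \<circ> ad (F_mat n (w ! 1)) \<circ> ad (F_mat n (w ! 2)))"

lemma m_tensor_single:
  "m_tensor n (Poly_Mapping.single w c) a b =
     Poly_Mapping.single (drop 3 w) (c * m_word n w a b)"
  unfolding m_tensor_def m_word_def
  by (subst sum_keys_single[where f = "\<lambda>w c. Poly_Mapping.single (drop 3 w) (c *
       op_coeff n (ad (F_mat n (w ! 0)) \<circ> ad (F_mat n (w ! 1)) \<circ> ad (F_mat n (w ! 2))) a b)"])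
     auto

lemma sum_const_single:
  "(\<Sum>x\<in>A. Poly_Mapping.single w (c :: 'a::field_char_0)) =
     Poly_Mapping.single w (of_nat (card A) * c)"
  by (induction A rule: infinite_finite_induct)
     (auto simp: single_add[symmetric] algebra_simps)

lemma ten_prod_symm_word: "ten_prod (symm_word c ys) = Poly_Mapping.single (mset ys) c"
proof -
  have "ten_prod (symm_word c ys) =
      (\<Sum>\<sigma> | \<sigma> permutes {..<length ys}. Poly_Mapping.single (mset ys) (c / fact (length ys)))"
    unfolding symm_word_def ten_prod_sum ten_prod_single by (rule sum.cong) auto
  then show ?thesis by (simp add: sum_const_single card_permutations del: sum_constant)
qed

lemma sum_single_keys: "(\<Sum>k\<in>Poly_Mapping.keys s. Poly_Mapping.single k (Poly_Mapping.lookup s k)) = s"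
  by (rule poly_mapping_eqI)
     (simp add: lookup_sum lookup_single when_def sum.delta sum.delta' in_keys_iff)

lemma some_mset: "mset (SOME ys. mset ys = M) = M"
  using someI_ex[OF ex_mset] .

lemma ten_prod_symm: "ten_prod (symm s) = s"
proof -
  have "ten_prod (symm s) =
      (\<Sum>M\<in>Poly_Mapping.keys s. Poly_Mapping.single M (Poly_Mapping.lookup s M))"
    unfolding symm_def ten_prod_sum ten_prod_symm_word some_mset ..
  then show ?thesis by (simp add: sum_single_keys)
qed

lemma shift_permutes:
  assumes \<tau>: "\<tau> permutes {..<m - 3}"
  defines "\<tau>' \<equiv> (\<lambda>i. if i < 3 then i else \<tau> (i - 3) + 3)"
  shows "\<tau>' permutes {..<m::nat}"
proof (rule bij_imp_permutes)
  have inj: "\<tau> x = \<tau> y \<longleftrightarrow> x = y" for x y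
    using permutes_inj[OF \<tau>] by (simp add: inj_eq)
  have out: "\<tau> x = x" if "x \<ge> m - 3" for x
    using \<tau> that by (auto simp: permutes_def)
  have inn: "\<tau> x < m - 3 \<longleftrightarrow> x < m - 3" for x
    using permutes_in_image[OF \<tau>, of x] by simp
  have "inj_on \<tau>' {..<m}"
    by (auto simp: inj_on_def \<tau>'_def inj split: if_splits)
  moreover have "\<tau>' ` {..<m} \<subseteq> {..<m}"
  proof
    fix y assume "y \<in> \<tau>' ` {..<m}"
    then obtain x where x: "x < m" "y = \<tau>' x" by auto
    then show "y \<in> {..<m}" using inn[of "x - 3"] by (auto simp: \<tau>'_def split: if_splits)
  qed
  ultimately show "bij_betw \<tau>' {..<m} {..<m}"
    by (simp add: bij_betw_def endo_inj_surj)
  show "\<tau>' x = x" if "x \<notin> {..<m}" for x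
    using that out[of "x - 3"] by (auto simp: \<tau>'_def)
qed

lemma permute_list_drop3:
  assumes \<tau>: "\<tau> permutes {..<length v - 3}"
  defines "\<tau>' \<equiv> (\<lambda>i. if i < 3 then i else \<tau> (i - 3) + 3)"
  shows "permute_list \<tau> (drop 3 v) = drop 3 (permute_list \<tau>' v)"
    and "m_word n (permute_list \<tau>' v) a b = m_word n v a b"
proof -
  have inn: "\<tau> x < length v - 3 \<longleftrightarrow> x < length v - 3" for x
    using permutes_in_image[OF \<tau>, of x] by simp
  show "permute_list \<tau> (drop 3 v) = drop 3 (permute_list \<tau>' v)"
    by (rule nth_equalityI)
       (use inn in \<open>auto simp: permute_list_def \<tau>'_def add.commute\<close>)
  show "m_word n (permute_list \<tau>' v) a b = m_word n v a b"
  proof (cases "length v \<ge> 3")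
    case True
    then have "permute_list \<tau>' v ! i = v ! i" if "i < 3" for i
      using that by (simp add: permute_list_def \<tau>'_def)
    then show ?thesis by (simp add: m_word_def)
  next
    case False
    then have "\<tau> = id" using \<tau> by simp
    then have "\<tau>' = id" by (auto simp: \<tau>'_def)
    then show ?thesis by simp
  qed
qed

lemma symm_m_tensor_word:
  "symm (ten_prod (m_tensor n (symm_word c ys) a b)) = m_tensor n (symm_word c ys) a b"
proof -
  define m where "m = length ys"
  define P where "P = {\<sigma>. \<sigma> permutes {..<m}}"
  define Q where "Q = {\<tau>. \<tau> permutes {..<m - 3}}"
  define d where "d = (\<lambda>\<sigma>. c / fact m * m_word n (permute_list \<sigma> ys) a b)"
  define sh where "sh = (\<lambda>\<tau> i. if i < 3 then i else \<tau> (i - 3) + 3 :: nat)"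
  have fin: "finite P" "finite Q" by (auto simp: P_def Q_def finite_permutations)
  have mt: "m_tensor n (symm_word c ys) a b =
      (\<Sum>\<sigma>\<in>P. Poly_Mapping.single (drop 3 (permute_list \<sigma> ys)) (d \<sigma>))"
    by (simp add: symm_word_def m_tensor_sum m_tensor_single P_def m_def d_def)
  have "symm (ten_prod (m_tensor n (symm_word c ys) a b)) =
      (\<Sum>\<sigma>\<in>P. symm_word (d \<sigma>) (drop 3 (permute_list \<sigma> ys)))"
    by (simp add: mt ten_prod_sum ten_prod_single symm_sum symm_single)
  also have "\<dots> = (\<Sum>\<sigma>\<in>P. \<Sum>\<tau>\<in>Q.
      Poly_Mapping.single (permute_list \<tau> (drop 3 (permute_list \<sigma> ys))) (d \<sigma> / fact (m - 3)))"
    by (simp add: symm_word_def Q_def m_def)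
  also have "\<dots> = (\<Sum>\<tau>\<in>Q. \<Sum>\<sigma>\<in>P.
      Poly_Mapping.single (permute_list \<tau> (drop 3 (permute_list \<sigma> ys))) (d \<sigma> / fact (m - 3)))"
    by (rule sum.swap)
  also have "\<dots> = (\<Sum>\<tau>\<in>Q. \<Sum>\<sigma>\<in>P.
      Poly_Mapping.single (drop 3 (permute_list \<sigma> ys)) (d \<sigma> / fact (m - 3)))"
  proof (rule sum.cong[OF refl])
    fix \<tau> assume "\<tau> \<in> Q"
    then have \<tau>: "\<tau> permutes {..<m - 3}" by (simp add: Q_def)
    have sh: "sh \<tau> permutes {..<m}" unfolding sh_def by (rule shift_permutes[OF \<tau>])
    have "(\<Sum>\<sigma>\<in>P.
          Poly_Mapping.single (permute_list \<tau> (drop 3 (permute_list \<sigma> ys))) (d \<sigma> / fact (m - 3))) =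
        (\<Sum>\<sigma>\<in>P.
          Poly_Mapping.single (drop 3 (permute_list (\<sigma> \<circ> sh \<tau>) ys)) (d (\<sigma> \<circ> sh \<tau>) / fact (m - 3)))"
    proof (rule sum.cong[OF refl])
      fix \<sigma> assume "\<sigma> \<in> P"
      have eq: "permute_list (\<sigma> \<circ> sh \<tau>) ys = permute_list (sh \<tau>) (permute_list \<sigma> ys)"
        using sh by (intro permute_list_compose) (simp add: m_def)
      have \<tau>2: "\<tau> permutes {..<length (permute_list \<sigma> ys) - 3}" using \<tau> by (simp add: m_def)
      show "Poly_Mapping.single (permute_list \<tau> (drop 3 (permute_list \<sigma> ys))) (d \<sigma> / fact (m - 3)) =
          Poly_Mapping.single (drop 3 (permute_list (\<sigma> \<circ> sh \<tau>) ys)) (d (\<sigma> \<circ> sh \<tau>) / fact (m - 3))"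
        unfolding d_def eq unfolding sh_def permute_list_drop3[OF \<tau>2] ..
    qed
    also have "\<dots> = (\<Sum>\<sigma>\<in>P.
          Poly_Mapping.single (drop 3 (permute_list \<sigma> ys)) (d \<sigma> / fact (m - 3)))"
      unfolding P_def
      using sum_permutations_compose_right[OF sh, of "\<lambda>\<sigma>.
          Poly_Mapping.single (drop 3 (permute_list \<sigma> ys)) (d \<sigma> / fact (m - 3))"]
      by simp
    finally show "(\<Sum>\<sigma>\<in>P.
          Poly_Mapping.single (permute_list \<tau> (drop 3 (permute_list \<sigma> ys))) (d \<sigma> / fact (m - 3))) =
        (\<Sum>\<sigma>\<in>P. Poly_Mapping.single (drop 3 (permute_list \<sigma> ys)) (d \<sigma> / fact (m - 3)))" .
  qed
  also have "\<dots> = (\<Sum>\<sigma>\<in>P. \<Sum>\<tau>\<in>Q.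
      Poly_Mapping.single (drop 3 (permute_list \<sigma> ys)) (d \<sigma> / fact (m - 3)))"
    by (rule sum.swap)
  also have "\<dots> = m_tensor n (symm_word c ys) a b"
    by (simp add: mt sum_const_single Q_def card_permutations del: sum_constant)
  finally show ?thesis .
qed

lemma symm_m_map: "symm (m_map n s a b) = m_tensor n (symm s) a b"
  unfolding m_map_def symm_def[of s]
  by (simp add: m_tensor_sum ten_prod_sum symm_sum symm_m_tensor_word)

end

theory Submission
  imports Defs "HOL-Library.Function_Algebras"
begin

text \<open>
  For \<open>s \<in> S\<^sup>m(\<gg>)\<close> the definitions unfold to
  \<open>m(s) = (m-3)!/m! \<Sum>\<^sub>a\<^sub>b\<^sub>c ad(F\<^sub>a) ad(F\<^sub>b) ad(F\<^sub>c) \<partial>\<^sub>a\<partial>\<^sub>b\<partial>\<^sub>c s\<close>, and the inclusion of \<open>s\<close> in \<open>\<gg> \<otimes> S\<^sup>m\<^sup>-\<^sup>1(\<gg>)\<close> is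
  \<open>1/m \<Sum>\<^sub>a ad(F\<^sub>a) \<partial>\<^sub>a s\<close>. Let \<open>X = (F\<^sub>i\<^sub>j)\<close>, \<open>P = det(1 - qX)\<inverse>\<close>, let \<open>H\<close> be the transpose of
  \<open>(1 - qX)\<inverse>\<close>, \<open>H'\<close> its transpose along the antidiagonal, and \<open>T = tr H\<close>. Jacobi's formula gives
  \<open>\<partial>\<^sub>a P = q P tr(H F\<^sub>a\<^sup>t)\<close> and \<open>\<partial>\<^sub>a H = q H F\<^sub>a\<^sup>t H\<close>, so the third derivatives of \<open>P\<close> are products of
  traces, and the sums over the basis are evaluated by the contractions
  \<open>\<Sum>\<^sub>a tr(K F\<^sub>a\<^sup>t) F\<^sub>a = K - K'\<close> and \<open>\<Sum>\<^sub>a F\<^sub>a K F\<^sub>a\<^sup>t = tr K - K'\<close>.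
  Because \<open>2 H H' = H + H'\<close>, all contributions to \<open>\<Sum>\<^sub>a\<^sub>b\<^sub>c ad(F\<^sub>a) ad(F\<^sub>b) ad(F\<^sub>c) Z\<close> with factors on both sides of
  \<open>Z\<close> cancel, and what remains is \<open>ad\<close> of
  \<open>q\<^sup>3 P ((T\<^sup>2 + tr H\<^sup>2 - 2T) (H - H') + (2T - 2) (H\<^sup>2 - H'\<^sup>2) + 2 (H\<^sup>3 - H'\<^sup>3))\<close>.
  With the Euler operator \<open>E = q d/dq\<close> one has \<open>E H = H\<^sup>2 - H\<close> and \<open>E P = P (T - n)\<close>, so this is
  \<open>q\<^sup>2 (n + E) (n + E - 1)\<close> applied to \<open>q P (H - H') = \<Sum>\<^sub>a \<partial>\<^sub>a P F\<^sub>a\<close>. Comparing coefficients of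
  \<open>q\<^sup>m\<^sup>+\<^sup>2\<close> yields the factor \<open>(n + m) (n + m - 1)\<close>.
\<close>

subsection \<open>Matrices and contractions over the basis\<close>

lemma sum_fun_apply: "(\<Sum>x\<in>A. f x) y = (\<Sum>x\<in>A. f x y)"
  by (induction A rule: infinite_finite_induct) auto

section \<open>Matrix algebra with transposition along the antidiagonal\<close>

type_synonym 'r fmat = "nat \<Rightarrow> nat \<Rightarrow> 'r"

definition scal :: "'r::comm_ring_1 \<Rightarrow> 'r fmat \<Rightarrow> 'r fmat"
  where "scal c A = (\<lambda>i j. c * A i j)"

definition transp :: "'r fmat \<Rightarrow> 'r fmat"
  where "transp A = (\<lambda>i j. A j i)"

lemma scal_apply: "scal c A i j = c * A i j"
  by (simp add: scal_def)

lemma scal_simps: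
  "scal c (A + B) = scal c A + scal c B"
  "scal c (A - B) = scal c A - scal c B"
  "scal c (- A) = - scal c A"
  "scal (c + d) A = scal c A + scal d A"
  "scal (c - d) A = scal c A - scal d A"
  "scal (- c) A = - scal c A"
  "scal c (scal d A) = scal (c * d) A"
  "scal 0 A = 0"
  "scal 1 A = A"
  by (simp_all add: fun_eq_iff scal_def algebra_simps)

lemma scal_sum: "scal c (\<Sum>x\<in>X. f x) = (\<Sum>x\<in>X. scal c (f x))"
  by (simp add: fun_eq_iff scal_def sum_fun_apply sum_distrib_left)

lemma sum_swap3:
  "(\<Sum>a\<in>A. \<Sum>k\<in>K. \<Sum>l\<in>L. f a k l) = (\<Sum>k\<in>K. \<Sum>l\<in>L. \<Sum>a\<in>A. f a k l)"
proof -
  have "(\<Sum>a\<in>A. \<Sum>k\<in>K. \<Sum>l\<in>L. f a k l) = (\<Sum>k\<in>K. \<Sum>a\<in>A. \<Sum>l\<in>L. f a k l)"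
    by (rule sum.swap)
  also have "\<dots> = (\<Sum>k\<in>K. \<Sum>l\<in>L. \<Sum>a\<in>A. f a k l)"
    by (rule sum.cong[OF refl], rule sum.swap)
  finally show ?thesis .
qed

text \<open>Matrices of varying size \<open>n\<close> are functions, multiplied as if zero outside \<open>{..<n}\<close>: this makes
  associativity and distributivity unconditional. The side condition \<open>supported\<close> is needed
  only for the laws that involve \<open>Id\<close> or compare entries.\<close>

locale square_matrices =
  fixes n :: nat
begin

definition mm :: "'r::comm_ring_1 fmat \<Rightarrow> 'r fmat \<Rightarrow> 'r fmat"  (infixl "\<star>" 70)
  where "A \<star> B = (\<lambda>i j. if i < n \<and> j < n then \<Sum>k<n. A i k * B k j else 0)"

definition tr :: "'r::comm_ring_1 fmat \<Rightarrow> 'r"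
  where "tr A = (\<Sum>i<n. A i i)"

definition antitransp :: "'r::comm_ring_1 fmat \<Rightarrow> 'r fmat"
  where "antitransp A = (\<lambda>i j. if i < n \<and> j < n then A (opp n j) (opp n i) else 0)"

definition Id :: "'r::comm_ring_1 fmat"
  where "Id = (\<lambda>i j. if i < n \<and> i = j then 1 else 0)"

definition supported :: "'r::comm_ring_1 fmat \<Rightarrow> bool"
  where "supported A \<longleftrightarrow> (\<forall>i j. \<not> (i < n \<and> j < n) \<longrightarrow> A i j = 0)"

text \<open>Given by entries over an arbitrary commutative ring, because the contractions are
  carried out over power series with coefficients in S(g). The index a and the position (i, j) enter
  symmetrically.\<close>

definition Fm :: "nat \<times> nat \<Rightarrow> 'r::comm_ring_1 fmat"
  where "Fm a = (\<lambda>i j. if i < n \<and> j < n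
    then (if a = (i, j) then 1 else 0) - (if a = (opp n j, opp n i) then 1 else 0) else 0)"

text \<open>The trace tr(K F_a^t) is the sum of all K_kl (F_a)_kl, the form in which derivatives in
  the direction a appear.\<close>

definition Ft :: "nat \<times> nat \<Rightarrow> 'r::comm_ring_1 fmat"
  where "Ft a = transp (Fm a)"

lemma mm_apply: "i < n \<Longrightarrow> j < n \<Longrightarrow> (A \<star> B) i j = (\<Sum>k<n. A i k * B k j)"
  by (simp add: mm_def)

lemma Fm_apply: "i < n \<Longrightarrow> j < n \<Longrightarrow>
    Fm a i j = (if a = (i, j) then 1 else 0) - (if a = (opp n j, opp n i) then 1 else 0)"
  by (simp add: Fm_def)

lemma mm_assoc: "(A \<star> B) \<star> C = A \<star> (B \<star> C)"
proof (intro ext)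
  fix i j
  show "((A \<star> B) \<star> C) i j = (A \<star> (B \<star> C)) i j"
  proof (cases "i < n \<and> j < n")
    case True
    then have "((A \<star> B) \<star> C) i j = (\<Sum>l<n. \<Sum>k<n. A i k * B k l * C l j)"
      by (simp add: mm_apply sum_distrib_right)
    also have "\<dots> = (\<Sum>k<n. \<Sum>l<n. A i k * B k l * C l j)"
      by (rule sum.swap)
    also have "\<dots> = (A \<star> (B \<star> C)) i j"
      using True by (simp add: mm_apply sum_distrib_left mult.assoc)
    finally show ?thesis .
  qed (auto simp: mm_def)
qed

lemma mm_distribs:
  "(A + B) \<star> C = A \<star> C + B \<star> C" "A \<star> (B + C) = A \<star> B + A \<star> C"
  "(A - B) \<star> C = A \<star> C - B \<star> C" "A \<star> (B - C) = A \<star> B - A \<star> C"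
  "(- A) \<star> C = - (A \<star> C)" "A \<star> (- C) = - (A \<star> C)"
  "0 \<star> C = 0" "A \<star> 0 = 0"
  "scal c A \<star> C = scal c (A \<star> C)" "A \<star> scal c C = scal c (A \<star> C)"
  by (auto simp: mm_def fun_eq_iff algebra_simps sum.distrib sum_subtractf sum_negf
      scal_def sum_distrib_left intro!: sum.cong)

lemma mm_sum:
  "(\<Sum>x\<in>X. f x) \<star> C = (\<Sum>x\<in>X. f x \<star> C)"
  "A \<star> (\<Sum>x\<in>X. f x) = (\<Sum>x\<in>X. A \<star> f x)"
  by (induction X rule: infinite_finite_induct) (auto simp: mm_distribs)

lemma tr_simps:
  "tr (A + B) = tr A + tr B" "tr (A - B) = tr A - tr B" "tr (- A) = - tr A"
  "tr (scal c A) = c * tr A" "tr 0 = 0"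
  by (auto simp: tr_def sum.distrib sum_subtractf sum_negf scal_def sum_distrib_left)

lemma tr_mm_commute: "tr (A \<star> B) = tr (B \<star> A)"
  unfolding tr_def by (simp add: mm_apply mult.commute) (rule sum.swap)

lemma bij_opp: "bij_betw (opp n) {..<n} {..<n}"
  by (rule bij_betw_byWitness[where f' = "opp n"]) (auto simp: opp_opp opp_less)

lemma antitransp_Id: "antitransp Id = Id"
proof -
  have "opp n j = opp n i \<longleftrightarrow> i = j" if "i < n" "j < n" for i j
    using that by (auto simp: opp_def)
  then show ?thesis
    by (simp add: antitransp_def Id_def opp_less fun_eq_iff)
qed

lemma antitransp_simps:
  "antitransp (A + B) = antitransp A + antitransp B" "antitransp (A - B) = antitransp A - antitransp B" "antitransp (- A) = - antitransp A"
  "antitransp (scal c A) = scal c (antitransp A)" "antitransp 0 = 0" "antitransp Id = Id"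
  by (simp_all add: antitransp_Id) (simp_all add: antitransp_def scal_def fun_eq_iff)

lemma antitransp_mm: "antitransp (A \<star> B) = antitransp B \<star> antitransp A"
proof (intro ext)
  fix i j
  show "antitransp (A \<star> B) i j = (antitransp B \<star> antitransp A) i j"
  proof (cases "i < n \<and> j < n")
    case True
    have "(\<Sum>k<n. A (opp n j) k * B k (opp n i)) =
        (\<Sum>k<n. A (opp n j) (opp n k) * B (opp n k) (opp n i))"
      by (rule sum.reindex_bij_betw[OF bij_opp, symmetric])
    then show ?thesis using True
      by (auto simp: antitransp_def mm_apply opp_less mult.commute)
  qed (auto simp: antitransp_def mm_def)
qed

lemma supportedI: "(\<And>i j. \<not> i < n \<Longrightarrow> A i j = 0) \<Longrightarrow> (\<And>i j. \<not> j < n \<Longrightarrow> A i j = 0) \<Longrightarrow> supported A"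
  unfolding supported_def by blast

lemma supported_mm [simp]: "supported (A \<star> B)"
  by (rule supportedI) (simp_all add: mm_def)

lemma supported_th [simp]: "supported (antitransp A)"
  by (rule supportedI) (simp_all add: antitransp_def)

lemma supported_Id [simp]: "supported Id"
  by (rule supportedI) (auto simp: Id_def)

lemma supported_Fm [simp]: "supported (Fm a)"
  by (rule supportedI) (simp_all add: Fm_def)

lemma supported_Ft [simp]: "supported (Ft a)"
  by (rule supportedI) (simp_all add: Fm_def Ft_def transp_def)

lemma supported_0 [simp]: "supported 0"
  by (rule supportedI) simp_all

lemma supported_combine [simp]:
  "supported A \<Longrightarrow> supported B \<Longrightarrow> supported (A + B)" "supported A \<Longrightarrow> supported B \<Longrightarrow> supported (A - B)"
  "supported A \<Longrightarrow> supported (- A)" "supported A \<Longrightarrow> supported (scal c A)"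
  by (auto simp: supported_def scal_def)

lemma supported_sum [simp]: "(\<And>x. x \<in> X \<Longrightarrow> supported (f x)) \<Longrightarrow> supported (\<Sum>x\<in>X. f x)"
  by (induction X rule: infinite_finite_induct) auto

lemma supported_eqI:
  "supported A \<Longrightarrow> supported B \<Longrightarrow> (\<And>i j. i < n \<Longrightarrow> j < n \<Longrightarrow> A i j = B i j) \<Longrightarrow> A = B"
  unfolding supported_def fun_eq_iff by metis

lemma antitransp_antitransp:
  assumes "supported A"
  shows "antitransp (antitransp A) = A"
proof (rule supported_eqI)
  show "antitransp (antitransp A) i j = A i j" if "i < n" "j < n" for i j
    using that by (simp add: antitransp_def opp_less opp_opp)
qed (simp_all add: assms)

lemma tr_th: "tr (antitransp A) = tr A"
  unfolding tr_def antitransp_def using sum.reindex_bij_betw[OF bij_opp, of "\<lambda>i. A i i"] by simp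

lemma mm_Id: "supported (A :: 'r::comm_ring_1 fmat) \<Longrightarrow> Id \<star> A = A" "supported A \<Longrightarrow> A \<star> Id = A"
proof -
  assume A: "supported A"
  have *: "(if P then 1 else 0) * x = (if P then x else 0)" "x * (if P then 1 else 0) = (if P then x else 0)"
    for P and x :: 'r
    by simp_all
  show "Id \<star> A = A"
    by (rule supported_eqI) (simp_all add: A mm_apply Id_def *)
  show "A \<star> Id = A"
    by (rule supported_eqI) (simp_all add: A mm_apply Id_def *)
qed

lemma antitransp_Fm: "antitransp (Fm a) = - Fm a"
proof (rule supported_eqI)
  show "antitransp (Fm a) i j = (- Fm a) i j" if "i < n" "j < n" for i j
    using that by (simp add: antitransp_def Fm_def opp_less opp_opp)
qed simp_all

section \<open>Contractions over the basis\<close>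

text \<open>Only a = (i, j) and a = (j', i') give a nonzero entry at (i, j). If i and j' differ,
  exactly one of them is a basis index, and since F_{j'i'} = -F_ij either one gives the same
  product. If i = j', neither is, and F_ij = 0.\<close>

lemma contraction:
  assumes "i < n" "j < n" "k < n" "l < n"
  shows "(\<Sum>a\<in>so_idx n. Fm a i j * Fm a k l) = (Fm (i, j) k l :: 'r::comm_ring_1)"
proof -
  let ?p = "(i, j)" and ?q = "(opp n j, opp n i)"
  have "(\<Sum>a\<in>so_idx n. Fm a i j * Fm a k l :: 'r) =
    (\<Sum>a\<in>so_idx n. (if a = ?p then Fm ?p k l else 0) - (if a = ?q then Fm ?q k l else 0))"
  proof (rule sum.cong[OF refl])
    fix a assume "a \<in> so_idx n"
    have *: "((if P then 1 else 0) - (if Q then 1 else 0)) * x =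
        (if P then x else 0) - (if Q then x else 0)" for P Q and x :: 'r
      by simp
    have **: "(if a = c then Fm a k l else 0) = (if a = c then Fm c k l else 0 :: 'r)" for c
      by simp
    have "Fm a i j = (if a = ?p then 1 else 0) - (if a = ?q then 1 else (0 :: 'r))"
      using assms by (simp add: Fm_def)
    then show "Fm a i j * Fm a k l =
        (if a = ?p then Fm ?p k l else 0) - (if a = ?q then Fm ?q k l else (0 :: 'r))"
      by (simp only: * **)
  qed
  also have "\<dots> = (if ?p \<in> so_idx n then Fm ?p k l else 0) - (if ?q \<in> so_idx n then Fm ?q k l else 0)"
    by (simp only: sum_subtractf sum.delta[OF finite_so_idx])
  also have "\<dots> = Fm ?p k l"
  proof -
    have pq: "Fm ?p k l = (if ?p = (k, l) then 1 else 0) - (if ?q = (k, l) then 1 else (0 :: 'r))"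
    proof -
      have "?p = (opp n l, opp n k) \<longleftrightarrow> ?q = (k, l)"
        using assms by (auto simp: opp_def)
      then show ?thesis using assms by (simp only: Fm_def) simp
    qed
    have q: "Fm ?q k l = (- Fm ?p k l :: 'r)"
    proof -
      have "?q = (opp n l, opp n k) \<longleftrightarrow> ?p = (k, l)"
        using assms by (auto simp: opp_def)
      then show ?thesis using assms unfolding pq by (simp only: Fm_def) simp
    qed
    consider "i < opp n j" | "i = opp n j" | "i > opp n j" by linarith
    then show ?thesis
    proof cases
      case 1
      then have "?p \<in> so_idx n" "?q \<notin> so_idx n"
        using assms by (auto simp: so_idx_def opp_def)
      then show ?thesis by simp
    next
      case 2
      then have "?p = ?q" using assms by (auto simp: opp_def)
      then have "Fm ?p k l = (0 :: 'r)" unfolding pq by (simp only: if_cancel diff_self)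
      then show ?thesis using q by simp
    next
      case 3
      then have "?p \<notin> so_idx n" "?q \<in> so_idx n"
        using assms by (auto simp: so_idx_def opp_def)
      then show ?thesis using q by simp
    qed
  qed
  finally show ?thesis .
qed

lemma sum_delta2:
  assumes "i < n" "j < n"
  shows "(\<Sum>k<n. \<Sum>l<n. K k l * ((if k = i \<and> l = j then 1 else 0))) = (K i j :: 'r::comm_ring_1)"
proof -
  have "(\<Sum>k<n. \<Sum>l<n. K k l * ((if k = i \<and> l = j then 1 else 0))) =
     (\<Sum>k<n. if k = i then \<Sum>l<n. if l = j then K k l else 0 else 0)"
    by (intro sum.cong refl) (auto simp: if_distrib cong: if_cong)
  then show ?thesis using assms by simp
qed

lemma sum_diag2:
  "(\<Sum>k<n. \<Sum>l<n. K k l * ((if k = l \<and> P then 1 else 0))) =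
     (if P then \<Sum>k<n. K k k else 0 :: 'r::comm_ring_1)"
proof -
  have "(\<Sum>k<n. \<Sum>l<n. K k l * ((if k = l \<and> P then 1 else 0))) =
     (\<Sum>k<n. \<Sum>l<n. if l = k then if P then K k l else 0 else 0)"
    by (intro sum.cong refl) auto
  then show ?thesis by simp
qed

text \<open>By \<open>contraction\<close> the two factors F_a become the entry (i, j) of F_kl, whose
  two deltas select K_ij and K_{j'i'}.\<close>

lemma contract_tr:
  assumes "supported K"
  shows "(\<Sum>a\<in>so_idx n. scal (tr (K \<star> Ft a)) (Fm a)) = K - antitransp K"
proof (rule supported_eqI)
  fix i j assume ij: "i < n" "j < n"
  have "(\<Sum>a\<in>so_idx n. scal (tr (K \<star> Ft a)) (Fm a)) i j =
      (\<Sum>a\<in>so_idx n. \<Sum>k<n. \<Sum>l<n. K k l * (Fm a k l * Fm a i j))"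
    by (simp add: sum_fun_apply scal_def tr_def mm_apply sum_distrib_right Ft_def transp_def mult.assoc)
  also have "\<dots> = (\<Sum>k<n. \<Sum>l<n. \<Sum>a\<in>so_idx n. K k l * (Fm a k l * Fm a i j))"
    by (rule sum_swap3)
  also have "\<dots> = (\<Sum>k<n. \<Sum>l<n. K k l * Fm (k, l) i j)"
    using ij by (simp add: contraction flip: sum_distrib_left)
  also have "\<dots> = (\<Sum>k<n. \<Sum>l<n. K k l * (if k = i \<and> l = j then 1 else 0)
      - K k l * (if k = opp n j \<and> l = opp n i then 1 else 0))"
    by (intro sum.cong refl) (use ij in \<open>simp add: Fm_def right_diff_distrib\<close>)
  also have "\<dots> = (K - antitransp K) i j"
    unfolding sum_subtractf sum_delta2[OF ij]
      sum_delta2[OF opp_less[OF ij(2)] opp_less[OF ij(1)]] by (simp add: antitransp_def ij)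
  finally show "(\<Sum>a\<in>so_idx n. scal (tr (K \<star> Ft a)) (Fm a)) i j = (K - antitransp K) i j" .
next
  show "supported (\<Sum>a\<in>so_idx n. scal (tr (K \<star> Ft a)) (Fm a))" by simp
next
  show "supported (K - antitransp K)" by (simp add: assms)
qed

text \<open>This is \<open>contract_tr\<close> for the transpose of K, since the two kinds of
  transposition commute.\<close>

lemma contract_tr_transp:
  assumes "supported K"
  shows "(\<Sum>a\<in>so_idx n. scal (tr (K \<star> Fm a)) (Ft a)) = K - antitransp K"
proof -
  have "tr (K \<star> Fm a) = tr (transp K \<star> Ft a)" for a
    by (simp add: tr_def mm_apply Ft_def transp_def) (rule sum.swap)
  then have "(\<Sum>a\<in>so_idx n. scal (tr (K \<star> Fm a)) (Ft a)) =
      transp (\<Sum>a\<in>so_idx n. scal (tr (transp K \<star> Ft a)) (Fm a))"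
    by (simp add: fun_eq_iff transp_def sum_fun_apply scal_def Ft_def)
  also have "\<dots> = transp (transp K - antitransp (transp K))"
    by (subst contract_tr) (use assms in \<open>auto simp: supported_def transp_def\<close>)
  also have "\<dots> = K - antitransp K"
    by (auto simp: fun_eq_iff transp_def antitransp_def)
  finally show ?thesis .
qed

text \<open>After \<open>contraction\<close> the first delta forces k = l and i = j, which produces
  the trace; the second selects the entry of \<open>antitransp K\<close>.\<close>

lemma contract_conj:
  "(\<Sum>a\<in>so_idx n. Fm a \<star> (K \<star> Ft a)) = scal (tr K) Id - antitransp K"
proof (rule supported_eqI)
  fix i j assume ij: "i < n" "j < n"
  have "(\<Sum>a\<in>so_idx n. Fm a \<star> (K \<star> Ft a)) i j =
      (\<Sum>a\<in>so_idx n. \<Sum>k<n. \<Sum>l<n. K k l * (Fm a i k * Fm a j l))"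
    using ij by (simp add: sum_fun_apply mm_apply sum_distrib_left Ft_def transp_def mult_ac)
  also have "\<dots> = (\<Sum>k<n. \<Sum>l<n. \<Sum>a\<in>so_idx n. K k l * (Fm a i k * Fm a j l))"
    by (rule sum_swap3)
  also have "\<dots> = (\<Sum>k<n. \<Sum>l<n. K k l * Fm (i, k) j l)"
    using ij by (simp add: contraction flip: sum_distrib_left)
  also have "\<dots> = (\<Sum>k<n. \<Sum>l<n. K k l * (if k = l \<and> i = j then 1 else 0)
      - K k l * (if k = opp n j \<and> l = opp n i then 1 else 0))"
  proof (intro sum.cong refl)
    fix k l assume kl: "k \<in> {..<n}" "l \<in> {..<n}"
    then have eqs: "(i, k) = (opp n l, opp n j) \<longleftrightarrow> k = opp n j \<and> l = opp n i"
      "(i, k) = (j, l) \<longleftrightarrow> k = l \<and> i = j"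
      using ij by (auto simp: opp_def)
    show "K k l * Fm (i, k) j l = K k l * (if k = l \<and> i = j then 1 else 0)
      - K k l * (if k = opp n j \<and> l = opp n i then 1 else 0)"
      unfolding Fm_apply[OF ij(2) kl(2)[unfolded lessThan_iff]] eqs right_diff_distrib ..
  qed
  also have "\<dots> = (scal (tr K) Id - antitransp K) i j"
    unfolding sum_subtractf sum_diag2
      sum_delta2[OF opp_less[OF ij(2)] opp_less[OF ij(1)]]
    by (simp add: antitransp_def scal_def Id_def tr_def ij)
  finally show "(\<Sum>a\<in>so_idx n. Fm a \<star> (K \<star> Ft a)) i j = (scal (tr K) Id - antitransp K) i j" .
qed simp_all


text \<open>Linearity lets a contraction act on one letter inside a longer word.\<close>

definition linear_op :: "('r::comm_ring_1 fmat \<Rightarrow> 'r fmat) \<Rightarrow> bool"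
  where "linear_op \<phi> \<longleftrightarrow>
    (\<forall>A B. \<phi> (A + B) = \<phi> A + \<phi> B) \<and> (\<forall>c A. \<phi> (scal c A) = scal c (\<phi> A))"

lemma linear_op_sum:
  assumes "linear_op \<phi>"
  shows "\<phi> (\<Sum>x\<in>X. f x) = (\<Sum>x\<in>X. \<phi> (f x))"
proof -
  have "\<phi> (scal 0 0) = scal 0 (\<phi> 0)" using assms by (simp only: linear_op_def)
  then have 0: "\<phi> 0 = 0" by (simp only: scal_simps)
  have plus: "\<phi> (A + B) = \<phi> A + \<phi> B" for A B using assms by (simp only: linear_op_def)
  show ?thesis
    by (induction X rule: infinite_finite_induct)
      (simp_all only: sum.infinite sum.empty sum.insert 0 plus not_False_eq_True)
qed

lemma linear_op_id: "linear_op (\<lambda>X. X)"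
  by (simp add: linear_op_def)

lemma linear_op_mm:
  "linear_op \<phi> \<Longrightarrow> linear_op (\<lambda>X. A \<star> \<phi> X)" "linear_op \<phi> \<Longrightarrow> linear_op (\<lambda>X. \<phi> X \<star> A)"
  by (simp_all add: linear_op_def mm_distribs)

lemmas linear_op_intros = linear_op_mm linear_op_id

text \<open>The scalar x carries the traces that do not involve the summation index.\<close>

lemma contract_tr_op:
  assumes "linear_op \<phi>" "supported K"
  shows "(\<Sum>a\<in>so_idx n. scal (x * tr (K \<star> Ft a)) (\<phi> (Fm a))) = scal x (\<phi> (K - antitransp K))"
proof -
  have *: "scal (x * tr (K \<star> Ft a)) (\<phi> (Fm a)) = scal x (\<phi> (scal (tr (K \<star> Ft a)) (Fm a)))" for a
    using assms(1) by (simp add: linear_op_def scal_simps)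
  show ?thesis
    unfolding contract_tr[OF assms(2), symmetric] linear_op_sum[OF assms(1)] scal_sum * ..
qed

lemma contract_tr_transp_op:
  assumes "linear_op \<phi>" "supported K"
  shows "(\<Sum>a\<in>so_idx n. scal (tr (K \<star> Fm a)) (\<phi> (Ft a))) = \<phi> (K - antitransp K)"
proof -
  have *: "scal (tr (K \<star> Fm a)) (\<phi> (Ft a)) = \<phi> (scal (tr (K \<star> Fm a)) (Ft a))" for a
    using assms(1) by (simp add: linear_op_def scal_simps)
  show ?thesis
    unfolding contract_tr_transp[OF assms(2), symmetric] linear_op_sum[OF assms(1)] * ..
qed

lemma contract_conj_op:
  assumes "supported V"
  shows "(\<Sum>a\<in>so_idx n. Fm a \<star> (K \<star> (Ft a \<star> V))) = scal (tr K) V - antitransp K \<star> V"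
proof -
  have "(\<Sum>a\<in>so_idx n. Fm a \<star> (K \<star> (Ft a \<star> V))) = (\<Sum>a\<in>so_idx n. Fm a \<star> (K \<star> Ft a)) \<star> V"
    by (simp add: mm_sum mm_assoc)
  then show ?thesis
    by (simp add: contract_conj mm_distribs mm_Id assms)
qed

lemma antitransp_Ft: "antitransp (Ft a) = - Ft a"
proof -
  have "antitransp (Ft a) = transp (antitransp (Fm a))"
    by (auto simp: fun_eq_iff Ft_def transp_def antitransp_def)
  then show ?thesis by (simp add: antitransp_Fm fun_eq_iff Ft_def transp_def)
qed

text \<open>A third derivative of \<open>det(1 - qX)\<inverse>\<close>, up to the factor \<open>q\<^sup>3 det(1 - qX)\<inverse>\<close>. There is one product of traces for each
  permutation of the three directions, all with sign \<open>+\<close> because the determinant is inverted.\<close>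

definition third_coeff :: "'r::comm_ring_1 fmat \<Rightarrow> nat \<times> nat \<Rightarrow> nat \<times> nat \<Rightarrow> nat \<times> nat \<Rightarrow> 'r"
  where "third_coeff H a b c =
    tr (H \<star> Ft a) * tr (H \<star> Ft b) * tr (H \<star> Ft c)
    + tr (H \<star> Ft a) * tr (H \<star> (Ft b \<star> (H \<star> Ft c)))
    + tr (H \<star> Ft b) * tr (H \<star> (Ft a \<star> (H \<star> Ft c)))
    + tr (H \<star> Ft c) * tr (H \<star> (Ft a \<star> (H \<star> Ft b)))
    + tr (H \<star> (Ft a \<star> (H \<star> (Ft b \<star> (H \<star> Ft c)))))
    + tr (H \<star> (Ft b \<star> (H \<star> (Ft a \<star> (H \<star> Ft c)))))"

section \<open>Contraction of words against the third derivative\<close>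

text \<open>The pairs F_a, F_a^t and F_b, F_b^t cross. The sum over a is a conjugation around K =
  F_b Z H, and \<open>antitransp K\<close> is -(Z H)' F_b, so the result splits into a trace term
  and a conjugation, both in b.\<close>

lemma contract_chain1:
  "(\<Sum>a\<in>so_idx n. \<Sum>b\<in>so_idx n. Fm a \<star> (Fm b \<star> (Z \<star> (H \<star> (Ft a \<star> (H \<star> (Ft b \<star> H)))))))
    = H \<star> ((Z \<star> H - antitransp (Z \<star> H)) \<star> H) + antitransp (Z \<star> H) \<star> (scal (tr H) H - antitransp H \<star> H)"
  if "supported H" for H :: "'r::comm_ring_1 fmat"
proof -
  have "(\<Sum>a\<in>so_idx n. Fm a \<star> (Fm b \<star> (Z \<star> (H \<star> (Ft a \<star> (H \<star> (Ft b \<star> H)))))))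
      = scal (tr ((Z \<star> H) \<star> Fm b)) (H \<star> (Ft b \<star> H)) + antitransp (Z \<star> H) \<star> (Fm b \<star> (H \<star> (Ft b \<star> H)))" for b
    using contract_conj_op[of "H \<star> (Ft b \<star> H)" "Fm b \<star> (Z \<star> H)"]
    by (simp add: mm_assoc antitransp_mm antitransp_Fm mm_distribs tr_mm_commute[of "Fm b"])
  then have "(\<Sum>b\<in>so_idx n. \<Sum>a\<in>so_idx n. Fm a \<star> (Fm b \<star> (Z \<star> (H \<star> (Ft a \<star> (H \<star> (Ft b \<star> H)))))))
    = (\<Sum>b\<in>so_idx n. scal (tr ((Z \<star> H) \<star> Fm b)) (H \<star> (Ft b \<star> H)))
      + antitransp (Z \<star> H) \<star> (\<Sum>b\<in>so_idx n. Fm b \<star> (H \<star> (Ft b \<star> H)))"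
    by (simp add: sum.distrib mm_sum)
  also have "(\<Sum>b\<in>so_idx n. scal (tr ((Z \<star> H) \<star> Fm b)) (H \<star> (Ft b \<star> H)))
    = H \<star> ((Z \<star> H - antitransp (Z \<star> H)) \<star> H)"
    by (rule contract_tr_transp_op[where \<phi> = "\<lambda>X. H \<star> (X \<star> H)"])
      (auto intro!: linear_op_intros)
  finally show ?thesis
    unfolding contract_conj_op[OF that] by (subst sum.swap)
qed

text \<open>The pairs are nested, so the inner sum over b and then the outer sum over a are
  conjugations.\<close>

lemma contract_chain2:
  "(\<Sum>a\<in>so_idx n. \<Sum>b\<in>so_idx n. Fm a \<star> (Fm b \<star> (Z \<star> (H \<star> (Ft b \<star> (H \<star> (Ft a \<star> H)))))))
    = (let X = (scal (tr (Z \<star> H)) Id - antitransp (Z \<star> H)) \<star> H in scal (tr X) H - antitransp X \<star> H)"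
  if "supported H" for H :: "'r::comm_ring_1 fmat"
proof -
  have "(\<Sum>b\<in>so_idx n. Fm a \<star> (Fm b \<star> (Z \<star> (H \<star> (Ft b \<star> (H \<star> (Ft a \<star> H)))))))
      = Fm a \<star> (((scal (tr (Z \<star> H)) Id - antitransp (Z \<star> H)) \<star> H) \<star> (Ft a \<star> H))" for a
    using contract_conj_op[of "H \<star> (Ft a \<star> H)" "Z \<star> H"]
    by (simp add: mm_assoc mm_distribs mm_Id flip: mm_sum)
  then show ?thesis
    by (simp add: contract_conj_op[OF that] Let_def)
qed

context
  fixes H :: "'r::comm_ring_1 fmat"
  assumes H: "supported H"
begin

text \<open>The value of F_b Y F_c summed against tr(H F_b^t H F_c^t), as
  \<open>contract_pair\<close> shows.\<close>

definition pair_sum :: "'r fmat \<Rightarrow> 'r fmat"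
  where "pair_sum Y = scal (tr (Y \<star> H)) H - antitransp (Y \<star> H) \<star> H
    + scal (tr (Y \<star> antitransp H)) (antitransp H) - antitransp (Y \<star> antitransp H) \<star> antitransp H"

text \<open>The sum over c replaces F_c by H F_b^t H - (H F_b^t H)' = H F_b^t H + H' F_b^t H',
  because F_b^t changes sign under \<open>antitransp\<close>. Both terms are then conjugations over
  b.\<close>

lemma contract_pair:
  assumes "linear_op \<phi>"
  shows "(\<Sum>b\<in>so_idx n. \<Sum>c\<in>so_idx n.
    scal (x * tr (H \<star> (Ft b \<star> (H \<star> Ft c)))) (\<phi> (Fm b \<star> (Y \<star> Fm c)))) = scal x (\<phi> (pair_sum Y))"
proof -
  have "(\<Sum>c\<in>so_idx n. scal (x * tr (H \<star> (Ft b \<star> (H \<star> Ft c)))) (\<phi> (Fm b \<star> (Y \<star> Fm c)))) =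
      scal x (\<phi> (Fm b \<star> ((Y \<star> H) \<star> (Ft b \<star> H)) + Fm b \<star> ((Y \<star> antitransp H) \<star> (Ft b \<star> antitransp H))))" for b
  proof -
    have "linear_op (\<lambda>X. \<phi> (Fm b \<star> (Y \<star> X)))"
      using assms by (simp add: linear_op_def mm_distribs)
    from contract_tr_op[OF this, of "H \<star> (Ft b \<star> H)" x] show ?thesis
      by (simp add: mm_assoc antitransp_mm antitransp_Ft mm_distribs)
  qed
  then have "(\<Sum>b\<in>so_idx n. \<Sum>c\<in>so_idx n.
      scal (x * tr (H \<star> (Ft b \<star> (H \<star> Ft c)))) (\<phi> (Fm b \<star> (Y \<star> Fm c)))) =
    scal x (\<phi> ((\<Sum>b\<in>so_idx n. Fm b \<star> ((Y \<star> H) \<star> (Ft b \<star> H)))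
       + (\<Sum>b\<in>so_idx n. Fm b \<star> ((Y \<star> antitransp H) \<star> (Ft b \<star> antitransp H)))))"
    by (simp add: linear_op_sum[OF assms] scal_sum flip: sum.distrib)
  also have "(\<Sum>b\<in>so_idx n. Fm b \<star> ((Y \<star> H) \<star> (Ft b \<star> H)))
       + (\<Sum>b\<in>so_idx n. Fm b \<star> ((Y \<star> antitransp H) \<star> (Ft b \<star> antitransp H))) = pair_sum Y"
    unfolding contract_conj_op[OF H] contract_conj_op[OF supported_th] pair_sum_def
    by (simp add: algebra_simps)
  finally show ?thesis .
qed

text \<open>The contribution of the two traces with three factors. The sum over c leaves a chain in
  H minus a chain in H' with a and b exchanged, so the two orders of a and b give two crossed and
  two nested chains.\<close>

definition chain_sum :: "'r fmat \<Rightarrow> 'r fmat"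
  where "chain_sum Z = H \<star> ((Z \<star> H - antitransp (Z \<star> H)) \<star> H)
    + antitransp (Z \<star> H) \<star> (scal (tr H) H - antitransp H \<star> H)
    - (let X = (scal (tr (Z \<star> antitransp H)) Id - antitransp (Z \<star> antitransp H)) \<star> antitransp H in scal (tr X) (antitransp H) - antitransp X \<star> antitransp H)
    + (let X = (scal (tr (Z \<star> H)) Id - antitransp (Z \<star> H)) \<star> H in scal (tr X) H - antitransp X \<star> H)
    - antitransp H \<star> ((Z \<star> antitransp H - antitransp (Z \<star> antitransp H)) \<star> antitransp H)
    - antitransp (Z \<star> antitransp H) \<star> (scal (tr H) (antitransp H) - H \<star> antitransp H)"

text \<open>The first four terms match the first four summands of \<open>third_coeff\<close>, and
  \<open>chain_sum\<close> the last two.\<close>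

definition word_sum :: "'r fmat \<Rightarrow> 'r fmat"
  where "word_sum Z = (H - antitransp H) \<star> ((H - antitransp H) \<star> (Z \<star> (H - antitransp H)))
    + (H - antitransp H) \<star> pair_sum Z
    + pair_sum ((H - antitransp H) \<star> Z)
    + pair_sum Id \<star> (Z \<star> (H - antitransp H))
    + chain_sum Z"

theorem contract_words:
  "(\<Sum>a\<in>so_idx n. \<Sum>b\<in>so_idx n. \<Sum>c\<in>so_idx n.
      scal (third_coeff H a b c) (Fm a \<star> (Fm b \<star> (Z \<star> Fm c)))) = word_sum Z"
proof -
  let ?I = "so_idx n" and ?S = "H - antitransp H"
  have T1: "(\<Sum>a\<in>?I. \<Sum>b\<in>?I. \<Sum>c\<in>?I. scal (tr (H \<star> Ft a) * tr (H \<star> Ft b) * tr (H \<star> Ft c))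
      (Fm a \<star> (Fm b \<star> (Z \<star> Fm c)))) = ?S \<star> (?S \<star> (Z \<star> ?S))"
  proof -
    have 1: "(\<Sum>c\<in>?I. scal (x * tr (H \<star> Ft c)) (Fm a \<star> (Fm b \<star> (Z \<star> Fm c)))) =
        scal x (Fm a \<star> (Fm b \<star> (Z \<star> ?S)))" for x a b
      by (rule contract_tr_op[where \<phi> = "\<lambda>X. Fm a \<star> (Fm b \<star> (Z \<star> X))"])
        (auto intro!: linear_op_intros H)
    have 2: "(\<Sum>b\<in>?I. scal (x * tr (H \<star> Ft b)) (Fm a \<star> (Fm b \<star> (Z \<star> ?S)))) =
        scal x (Fm a \<star> (?S \<star> (Z \<star> ?S)))" for x a
      by (rule contract_tr_op[where \<phi> = "\<lambda>X. Fm a \<star> (X \<star> (Z \<star> ?S))"])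
        (auto intro!: linear_op_intros H)
    have 3: "(\<Sum>a\<in>?I. scal (1 * tr (H \<star> Ft a)) (Fm a \<star> (?S \<star> (Z \<star> ?S)))) =
        scal 1 (?S \<star> (?S \<star> (Z \<star> ?S)))"
      by (rule contract_tr_op[where \<phi> = "\<lambda>X. X \<star> (?S \<star> (Z \<star> ?S))"])
        (auto intro!: linear_op_intros H)
    show ?thesis unfolding 1 2 using 3 by (simp add: scal_simps)
  qed
  have T2: "(\<Sum>a\<in>?I. \<Sum>b\<in>?I. \<Sum>c\<in>?I. scal (tr (H \<star> Ft a) * tr (H \<star> (Ft b \<star> (H \<star> Ft c))))
      (Fm a \<star> (Fm b \<star> (Z \<star> Fm c)))) = ?S \<star> pair_sum Z"
  proof -
    have 1: "(\<Sum>b\<in>?I. \<Sum>c\<in>?I. scal (x * tr (H \<star> (Ft b \<star> (H \<star> Ft c))))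
        (Fm a \<star> (Fm b \<star> (Z \<star> Fm c)))) = scal x (Fm a \<star> pair_sum Z)" for x a
      by (rule contract_pair[where \<phi> = "\<lambda>X. Fm a \<star> X"]) (auto intro!: linear_op_intros)
    have 2: "(\<Sum>a\<in>?I. scal (1 * tr (H \<star> Ft a)) (Fm a \<star> pair_sum Z)) = scal 1 (?S \<star> pair_sum Z)"
      by (rule contract_tr_op[where \<phi> = "\<lambda>X. X \<star> pair_sum Z"])
        (auto intro!: linear_op_intros H)
    show ?thesis unfolding 1 using 2 by (simp add: scal_simps)
  qed
  have T3: "(\<Sum>a\<in>?I. \<Sum>b\<in>?I. \<Sum>c\<in>?I. scal (tr (H \<star> Ft b) * tr (H \<star> (Ft a \<star> (H \<star> Ft c))))
      (Fm a \<star> (Fm b \<star> (Z \<star> Fm c)))) = pair_sum (?S \<star> Z)"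
  proof -
    have 1: "(\<Sum>b\<in>?I. scal (tr (H \<star> Ft b) * x) (Fm a \<star> (Fm b \<star> (Z \<star> Fm c)))) =
        scal x (Fm a \<star> (?S \<star> (Z \<star> Fm c)))" for x a c
      unfolding mult.commute[of _ x]
      by (rule contract_tr_op[where \<phi> = "\<lambda>X. Fm a \<star> (X \<star> (Z \<star> Fm c))"])
        (auto intro!: linear_op_intros H)
    have 2: "(\<Sum>a\<in>?I. \<Sum>c\<in>?I. scal (1 * tr (H \<star> (Ft a \<star> (H \<star> Ft c))))
        (Fm a \<star> ((?S \<star> Z) \<star> Fm c))) = scal 1 (pair_sum (?S \<star> Z))"
      by (rule contract_pair[where \<phi> = "\<lambda>X. X"]) (rule linear_op_id)
    \<comment> \<open>The index b has a trace of its own, so it is summed first; what remains pairs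
      a with c around \<open>?S \<star> Z\<close>.\<close>
    have "(\<Sum>a\<in>?I. \<Sum>b\<in>?I. \<Sum>c\<in>?I. scal (tr (H \<star> Ft b) * tr (H \<star> (Ft a \<star> (H \<star> Ft c))))
        (Fm a \<star> (Fm b \<star> (Z \<star> Fm c)))) =
      (\<Sum>a\<in>?I. \<Sum>c\<in>?I. \<Sum>b\<in>?I. scal (tr (H \<star> Ft b) * tr (H \<star> (Ft a \<star> (H \<star> Ft c))))
        (Fm a \<star> (Fm b \<star> (Z \<star> Fm c))))"
      by (rule sum.cong[OF refl], rule sum.swap)
    then show ?thesis unfolding 1 using 2 by (simp add: scal_simps mm_assoc)
  qed
  have T4: "(\<Sum>a\<in>?I. \<Sum>b\<in>?I. \<Sum>c\<in>?I. scal (tr (H \<star> Ft c) * tr (H \<star> (Ft a \<star> (H \<star> Ft b))))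
      (Fm a \<star> (Fm b \<star> (Z \<star> Fm c)))) = pair_sum Id \<star> (Z \<star> ?S)"
  proof -
    have 1: "(\<Sum>c\<in>?I. scal (tr (H \<star> Ft c) * x) (Fm a \<star> (Fm b \<star> (Z \<star> Fm c)))) =
        scal x (Fm a \<star> (Fm b \<star> (Z \<star> ?S)))" for x a b
      unfolding mult.commute[of _ x]
      by (rule contract_tr_op[where \<phi> = "\<lambda>X. Fm a \<star> (Fm b \<star> (Z \<star> X))"])
        (auto intro!: linear_op_intros H)
    \<comment> \<open>Once c is summed out, F_a and F_b are adjacent, and \<open>Id\<close> fills
      the middle slot of \<open>contract_pair\<close>.\<close>
    have 2: "(\<Sum>a\<in>?I. \<Sum>b\<in>?I. scal (1 * tr (H \<star> (Ft a \<star> (H \<star> Ft b))))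
        ((Fm a \<star> (Id \<star> Fm b)) \<star> (Z \<star> ?S))) = scal 1 (pair_sum Id \<star> (Z \<star> ?S))"
      by (rule contract_pair[where \<phi> = "\<lambda>X. X \<star> (Z \<star> ?S)"]) (auto intro!: linear_op_intros)
    show ?thesis unfolding 1 using 2 by (simp add: scal_simps mm_assoc mm_Id)
  qed
  have T56: "(\<Sum>c\<in>?I. scal (tr (H \<star> (Ft a \<star> (H \<star> (Ft b \<star> (H \<star> Ft c))))))
        (Fm a \<star> (Fm b \<star> (Z \<star> Fm c)))) =
      Fm a \<star> (Fm b \<star> (Z \<star> (H \<star> (Ft a \<star> (H \<star> (Ft b \<star> H))))))
      - Fm a \<star> (Fm b \<star> (Z \<star> (antitransp H \<star> (Ft b \<star> (antitransp H \<star> (Ft a \<star> antitransp H))))))"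
    "(\<Sum>c\<in>?I. scal (tr (H \<star> (Ft b \<star> (H \<star> (Ft a \<star> (H \<star> Ft c))))))
        (Fm a \<star> (Fm b \<star> (Z \<star> Fm c)))) =
      Fm a \<star> (Fm b \<star> (Z \<star> (H \<star> (Ft b \<star> (H \<star> (Ft a \<star> H))))))
      - Fm a \<star> (Fm b \<star> (Z \<star> (antitransp H \<star> (Ft a \<star> (antitransp H \<star> (Ft b \<star> antitransp H))))))" for a b
  proof -
    have "linear_op (\<lambda>X. Fm a \<star> (Fm b \<star> (Z \<star> X)))"
      by (intro linear_op_intros)
    from contract_tr_op[OF this, of "H \<star> (Ft a \<star> (H \<star> (Ft b \<star> H)))" 1]
      contract_tr_op[OF this, of "H \<star> (Ft b \<star> (H \<star> (Ft a \<star> H)))" 1]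
    show "(\<Sum>c\<in>?I. scal (tr (H \<star> (Ft a \<star> (H \<star> (Ft b \<star> (H \<star> Ft c))))))
        (Fm a \<star> (Fm b \<star> (Z \<star> Fm c)))) =
      Fm a \<star> (Fm b \<star> (Z \<star> (H \<star> (Ft a \<star> (H \<star> (Ft b \<star> H))))))
      - Fm a \<star> (Fm b \<star> (Z \<star> (antitransp H \<star> (Ft b \<star> (antitransp H \<star> (Ft a \<star> antitransp H))))))"
      "(\<Sum>c\<in>?I. scal (tr (H \<star> (Ft b \<star> (H \<star> (Ft a \<star> (H \<star> Ft c))))))
        (Fm a \<star> (Fm b \<star> (Z \<star> Fm c)))) =
      Fm a \<star> (Fm b \<star> (Z \<star> (H \<star> (Ft b \<star> (H \<star> (Ft a \<star> H))))))
      - Fm a \<star> (Fm b \<star> (Z \<star> (antitransp H \<star> (Ft a \<star> (antitransp H \<star> (Ft b \<star> antitransp H))))))"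
      by (simp_all add: mm_assoc antitransp_mm antitransp_Ft mm_distribs scal_simps)
  qed
  have "(\<Sum>a\<in>?I. \<Sum>b\<in>?I. \<Sum>c\<in>?I.
      scal (third_coeff H a b c) (Fm a \<star> (Fm b \<star> (Z \<star> Fm c)))) =
    ?S \<star> (?S \<star> (Z \<star> ?S)) + ?S \<star> pair_sum Z + pair_sum (?S \<star> Z) + pair_sum Id \<star> (Z \<star> ?S)
    + ((\<Sum>a\<in>?I. \<Sum>b\<in>?I. Fm a \<star> (Fm b \<star> (Z \<star> (H \<star> (Ft a \<star> (H \<star> (Ft b \<star> H)))))))
      - (\<Sum>a\<in>?I. \<Sum>b\<in>?I. Fm a \<star> (Fm b \<star> (Z \<star> (antitransp H \<star> (Ft b \<star> (antitransp H \<star> (Ft a \<star> antitransp H))))))))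
    + ((\<Sum>a\<in>?I. \<Sum>b\<in>?I. Fm a \<star> (Fm b \<star> (Z \<star> (H \<star> (Ft b \<star> (H \<star> (Ft a \<star> H)))))))
      - (\<Sum>a\<in>?I. \<Sum>b\<in>?I. Fm a \<star> (Fm b \<star> (Z \<star> (antitransp H \<star> (Ft a \<star> (antitransp H \<star> (Ft b \<star> antitransp H))))))))"
    unfolding third_coeff_def scal_simps(4) sum.distrib T1 T2 T3 T4 T56 sum_subtractf ..
  also have "\<dots> = word_sum Z"
    unfolding contract_chain1[OF H] contract_chain1[OF supported_th] contract_chain2[OF H]
      contract_chain2[OF supported_th] word_sum_def chain_sum_def antitransp_antitransp[OF H] tr_th Let_def
    by (simp add: algebra_simps)
  finally show ?thesis .
qed

end

end

section \<open>Evaluation in the commutative algebra generated by H and H'\<close>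

context square_matrices
begin

text \<open>W stands for H H', and the assumptions are the relations that
  \<open>resolvent_relations\<close> provides for the resolvent.\<close>

context
  fixes H W :: "'r::comm_ring_1 fmat"
  assumes H: "supported H" and W: "supported W"
    and antitransp_H: "antitransp H = scal 2 W - H" and antitransp_W: "antitransp W = W"
    and HW: "W \<star> H = H \<star> W" and HH: "H \<star> H = scal 2 (H \<star> W) - W"
    and no_2_torsion: "\<forall>x :: 'r. 2 * x = 0 \<longrightarrow> x = 0"
begin

text \<open>The commutation and reduction rules for letters followed by a further factor, as
  right-nested words need them.\<close>

lemma left_rules:
  "W \<star> (H \<star> X) = H \<star> (W \<star> X)" "H \<star> (H \<star> X) = scal 2 (H \<star> (W \<star> X)) - W \<star> X"
  by (simp_all add: HW HH mm_distribs flip: mm_assoc)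

text \<open>The trace is invariant under \<open>antitransp\<close>, which sends H to 2W - H and H W
  to 2W^2 - W H.\<close>

lemma tr_W: "tr W = tr H" "tr (W \<star> W) = tr (H \<star> W)"
proof -
  have "2 * (tr W - tr H) = 0"
    using tr_th[of H] by (simp add: antitransp_H tr_simps algebra_simps)
  from no_2_torsion[rule_format, OF this] show "tr W = tr H" by simp
  have "2 * (tr (W \<star> W) - tr (H \<star> W)) = 0"
    using tr_th[of "H \<star> W"] by (simp add: antitransp_H antitransp_W antitransp_mm tr_simps mm_distribs HW algebra_simps)
  from no_2_torsion[rule_format, OF this] show "tr (W \<star> W) = tr (H \<star> W)" by simp
qed

lemmas normalize_simps = mm_distribs scal_simps antitransp_simps antitransp_mm mm_assoc tr_simps
  antitransp_H antitransp_W HW HH left_rules mm_Id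

text \<open>Both identities below are checked by rewriting to the normal form in which every word in
  \<open>H\<close> and \<open>W\<close> is \<open>W\<^sup>i\<close> or \<open>H W\<^sup>i\<close>.\<close>

lemma word_sum_Id:
  "word_sum H Id = scal (tr H ^ 2 + tr (H \<star> H) - 2 * tr H) (H - antitransp H)
    + scal (2 * tr H - 2) (H \<star> H - antitransp H \<star> antitransp H)
    + scal 2 (H \<star> (H \<star> H) - antitransp H \<star> (antitransp H \<star> antitransp H))"
  unfolding word_sum_def[OF H] pair_sum_def[OF H] chain_sum_def[OF H] Let_def
  by (simp only: normalize_simps H W supported_mm supported_Id tr_W,
      simp only: fun_eq_iff scal_apply plus_fun_apply minus_apply uminus_apply)
    (simp add: algebra_simps power2_eq_square)

context
  fixes Z :: "'r fmat"
  assumes Z: "supported Z" and antitransp_Z: "antitransp Z = - Z"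
begin

text \<open>Z changes sign under \<open>antitransp\<close> while W and its square are fixed, so each
  trace is its own negative.\<close>

lemma tr_skew: "tr (Z \<star> W) = 0" "tr (Z \<star> (W \<star> W)) = 0"
proof -
  have "2 * tr (Z \<star> W) = 0"
    using tr_th[of "Z \<star> W"] tr_mm_commute[of Z W]
    by (simp add: antitransp_mm antitransp_Z antitransp_W mm_distribs tr_simps eq_neg_iff_add_eq_0)
  then show "tr (Z \<star> W) = 0" by (rule no_2_torsion[rule_format])
  have "2 * tr (Z \<star> (W \<star> W)) = 0"
    using tr_th[of "Z \<star> (W \<star> W)"] tr_mm_commute[of Z "W \<star> W"]
    by (simp add: antitransp_mm antitransp_Z antitransp_W mm_distribs tr_simps eq_neg_iff_add_eq_0 mm_assoc)
  then show "tr (Z \<star> (W \<star> W)) = 0" by (rule no_2_torsion[rule_format])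
qed

text \<open>Cyclic invariance, oriented so that every trace starts with Z.\<close>

lemma tr_rotate:
  "tr (H \<star> Z) = tr (Z \<star> H)" "tr (W \<star> Z) = tr (Z \<star> W)"
  "tr (H \<star> (Z \<star> X)) = tr (Z \<star> (X \<star> H))" "tr (W \<star> (Z \<star> X)) = tr (Z \<star> (X \<star> W))"
  "tr (H \<star> (W \<star> Z)) = tr (Z \<star> (H \<star> W))" "tr (W \<star> (W \<star> Z)) = tr (Z \<star> (W \<star> W))"
  "tr (H \<star> (W \<star> (Z \<star> X))) = tr (Z \<star> (X \<star> (H \<star> W)))"
  "tr (W \<star> (W \<star> (Z \<star> X))) = tr (Z \<star> (X \<star> (W \<star> W)))"
  using tr_mm_commute[of H Z] tr_mm_commute[of W Z] tr_mm_commute[of H "Z \<star> X"]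
    tr_mm_commute[of W "Z \<star> X"] tr_mm_commute[of "H \<star> W" Z] tr_mm_commute[of "W \<star> W" Z]
    tr_mm_commute[of "H \<star> W" "Z \<star> X"] tr_mm_commute[of "W \<star> W" "Z \<star> X"]
  by (simp_all only: mm_assoc)

lemma word_sum_skew: "antitransp (word_sum H Z) = word_sum H Z"
  unfolding word_sum_def[OF H] pair_sum_def[OF H] chain_sum_def[OF H] Let_def
  by (simp only: normalize_simps H W supported_mm supported_Id Z antitransp_Z tr_skew tr_rotate tr_W,
      simp only: fun_eq_iff scal_apply plus_fun_apply minus_apply uminus_apply)
    (simp add: algebra_simps)

end

end

end

subsection \<open>Derivations and the resolvent\<close>

locale derivation =
  fixes D :: "'r::comm_ring_1 \<Rightarrow> 'r"
  assumes add: "D (x + y) = D x + D y"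
    and mult: "D (x * y) = D x * y + x * D y"
begin

lemma zero: "D 0 = 0"
  using add[of 0 0] by simp

lemma one: "D 1 = 0"
  using mult[of 1 1] by simp

lemma minus: "D (- x) = - D x"
  using add[of x "- x"] zero by (simp add: eq_neg_iff_add_eq_0 add.commute)

lemma diff: "D (x - y) = D x - D y"
  using add[of x "- y"] by (simp add: minus)

lemma sum: "D (\<Sum>x\<in>X. f x) = (\<Sum>x\<in>X. D (f x))"
  by (induction X rule: infinite_finite_induct) (simp_all add: zero add)

text \<open>The \<open>if\<close> marks the differentiated factor; this is the shape of a
  determinant with one row replaced.\<close>

lemma prod:
  "finite X \<Longrightarrow> D (\<Prod>x\<in>X. f x) = (\<Sum>x\<in>X. \<Prod>y\<in>X. if y = x then D (f y) else f y)"
proof (induction X rule: finite_induct)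
  case empty
  then show ?case by (simp add: one)
next
  case (insert z X)
  have "(\<Prod>y\<in>X. if y = z then D (f y) else f y) = (\<Prod>y\<in>X. f y)"
    by (rule prod.cong) (use insert in auto)
  moreover have "(\<Prod>y\<in>insert z X. if y = x then D (f y) else f y) =
      f z * (\<Prod>y\<in>X. if y = x then D (f y) else f y)" if "x \<in> X" for x
    using insert that by (subst prod.insert) auto
  ultimately show ?case
    using insert by (simp add: mult sum_distrib_left)
qed

text \<open>Jacobi's formula. The permutation expansion is differentiated one row at a time;
  expanding along the differentiated row i only meets cofactors of A, because deleting row i removes
  the change.\<close>

lemma det:
  assumes A: "A \<in> carrier_mat n n"
  shows "D (det A) = (\<Sum>i<n. \<Sum>j<n. D (A $$ (i, j)) * cofactor A i j)"
proof -
  define B where "B i = mat n n (\<lambda>(r, c). if r = i then D (A $$ (r, c)) else A $$ (r, c))" for i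
  have B: "B i \<in> carrier_mat n n" for i by (simp add: B_def)
  have sgn: "D (signof p * x) = signof p * D x" for p x
    by (simp add: sign_def mult minus one)
  have "D (det A) = (\<Sum>p | p permutes {0..<n}. \<Sum>i\<in>{0..<n}.
      signof p * (\<Prod>r\<in>{0..<n}. if r = i then D (A $$ (r, p r)) else A $$ (r, p r)))"
    unfolding det_def'[OF A] sum sgn prod[OF finite_atLeastLessThan] sum_distrib_left ..
  also have "\<dots> = (\<Sum>i\<in>{0..<n}. \<Sum>p | p permutes {0..<n}.
      signof p * (\<Prod>r\<in>{0..<n}. if r = i then D (A $$ (r, p r)) else A $$ (r, p r)))"
    by (rule sum.swap)
  also have "\<dots> = (\<Sum>i\<in>{0..<n}. det (B i))"
  proof (rule sum.cong[OF refl])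
    fix i
    show "(\<Sum>p | p permutes {0..<n}.
      signof p * (\<Prod>r\<in>{0..<n}. if r = i then D (A $$ (r, p r)) else A $$ (r, p r))) = det (B i)"
      unfolding det_def'[OF B]
    proof (rule sum.cong[OF refl])
      fix p assume "p \<in> {p. p permutes {0..<n}}"
      then have "p r < n" if "r < n" for r
        using that permutes_in_image[of p "{0..<n}" r] by simp
      then show "signof p * (\<Prod>r\<in>{0..<n}. if r = i then D (A $$ (r, p r)) else A $$ (r, p r)) =
          signof p * (\<Prod>r = 0..<n. B i $$ (r, p r))"
        by (intro arg_cong2[of _ _ _ _ "(*)"] refl prod.cong) (simp_all add: B_def)
    qed
  qed
  also have "\<dots> = (\<Sum>i<n. \<Sum>j<n. D (A $$ (i, j)) * cofactor A i j)"
    unfolding atLeast0LessThan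
  proof (rule sum.cong[OF refl])
    fix i assume "i \<in> {..<n}"
    then have i: "i < n" by simp
    have "mat_delete (B i) i j = mat_delete A i j" for j
      using A by (intro eq_matI) (auto simp: mat_delete_def B_def)
    then have "cofactor (B i) i j = cofactor A i j" for j
      by (simp add: cofactor_def)
    then show "det (B i) = (\<Sum>j<n. D (A $$ (i, j)) * cofactor A i j)"
      unfolding laplace_expansion_row[OF B i] using i by (simp add: B_def)
  qed
  finally show ?thesis .
qed

end

definition map_entries :: "('r \<Rightarrow> 's) \<Rightarrow> 'r fmat \<Rightarrow> 's fmat"
  where "map_entries D A = (\<lambda>i j. D (A i j))"

context square_matrices
begin

lemma map_entries_derivation:
  assumes "derivation D"
  shows "map_entries D (A \<star> B) = map_entries D A \<star> B + A \<star> map_entries D B"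
    "map_entries D (A + B) = map_entries D A + map_entries D B"
    "map_entries D (A - B) = map_entries D A - map_entries D B"
    "map_entries D (scal c A) = scal (D c) A + scal c (map_entries D A)"
    "map_entries D (antitransp A) = antitransp (map_entries D A)"
    "map_entries D Id = 0"
    "D (tr A) = tr (map_entries D A)"
    "supported A \<Longrightarrow> supported (map_entries D A)"
proof -
  interpret derivation D by fact
  show "map_entries D (A \<star> B) = map_entries D A \<star> B + A \<star> map_entries D B"
    by (auto simp: map_entries_def mm_def fun_eq_iff sum mult sum.distrib zero)
  show "map_entries D (A + B) = map_entries D A + map_entries D B"
    "map_entries D (A - B) = map_entries D A - map_entries D B"
    "map_entries D (scal c A) = scal (D c) A + scal c (map_entries D A)"
    by (auto simp: map_entries_def fun_eq_iff add diff scal_def mult)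
  show "map_entries D (antitransp A) = antitransp (map_entries D A)"
    by (simp add: map_entries_def fun_eq_iff antitransp_def zero)
  show "map_entries D Id = 0"
    by (simp add: map_entries_def fun_eq_iff Id_def zero one)
  show "D (tr A) = tr (map_entries D A)"
    by (simp add: map_entries_def tr_def sum)
  show "supported A \<Longrightarrow> supported (map_entries D A)"
    by (simp add: map_entries_def supported_def zero)
qed

section \<open>Expansion of triple commutators\<close>

definition ad_op :: "'r::comm_ring_1 fmat \<Rightarrow> 'r fmat \<Rightarrow> 'r fmat"
  where "ad_op A Z = A \<star> Z - Z \<star> A"

text \<open>Symmetry in the three directions comes from cyclicity of the trace; this transposition
  and the following 3-cycle generate all permutations.\<close>

lemma third_coeff_swap: "third_coeff H b a c = third_coeff H a b c"
  using tr_mm_commute[of "H \<star> Ft a" "H \<star> Ft b"]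
  by (simp add: third_coeff_def mm_assoc algebra_simps)

lemma third_coeff_rotate: "third_coeff H b c a = third_coeff H a b c"
  using tr_mm_commute[of "H \<star> Ft a" "H \<star> Ft b"] tr_mm_commute[of "H \<star> Ft a" "H \<star> Ft c"]
    tr_mm_commute[of "H \<star> Ft b" "H \<star> Ft c"]
    tr_mm_commute[of "H \<star> Ft a" "H \<star> (Ft b \<star> (H \<star> Ft c))"]
    tr_mm_commute[of "H \<star> (Ft c \<star> (H \<star> Ft b))" "H \<star> Ft a"]
    tr_mm_commute[of "H \<star> (Ft b \<star> (H \<star> Ft a))" "H \<star> Ft c"]
  by (simp add: third_coeff_def mm_assoc algebra_simps)

text \<open>Of the eight words, those with Z at an end reduce to \<open>L Id\<close> and its
  \<open>antitransp\<close>. A word with one letter to the right of Z becomes \<open>L Z\<close>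
  after renaming indices, by symmetry of w. A word with two is the \<open>antitransp\<close> of such
  a word, the sign changes of three F and one Z cancelling.\<close>

lemma sum_ad_expand:
  assumes Z: "supported Z" "antitransp Z = - Z"
    and w: "\<And>a b c. w b a c = w a b c" "\<And>a b c. w b c a = w a b c"
  defines "L \<equiv> \<lambda>Y. \<Sum>a\<in>so_idx n. \<Sum>b\<in>so_idx n. \<Sum>c\<in>so_idx n.
    scal (w a b c) (Fm a \<star> (Fm b \<star> (Y \<star> Fm c)))"
  shows "(\<Sum>a\<in>so_idx n. \<Sum>b\<in>so_idx n. \<Sum>c\<in>so_idx n.
    scal (w a b c) (ad_op (Fm a) (ad_op (Fm b) (ad_op (Fm c) Z)))) =
    L Id \<star> Z + Z \<star> antitransp (L Id) - scal 3 (L Z) + scal 3 (antitransp (L Z))"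
proof -
  let ?I = "so_idx n"
  have w': "w a c b = w a b c" for a b c
    using w by metis
  have thsum: "antitransp (sum f X) = (\<Sum>x\<in>X. antitransp (f x))" for f :: "'z \<Rightarrow> 'a fmat" and X
    by (auto simp: fun_eq_iff antitransp_def sum_fun_apply)
  have 1: "(\<Sum>a\<in>?I. \<Sum>b\<in>?I. \<Sum>c\<in>?I. scal (w a b c) (Fm a \<star> (Fm b \<star> (Fm c \<star> Z)))) = L Id \<star> Z"
    by (simp add: L_def mm_sum mm_distribs mm_Id mm_assoc)
  have 8: "(\<Sum>a\<in>?I. \<Sum>b\<in>?I. \<Sum>c\<in>?I. scal (w a b c) (Z \<star> (Fm c \<star> (Fm b \<star> Fm a)))) = - (Z \<star> antitransp (L Id))"
    by (simp add: L_def thsum mm_sum mm_distribs mm_Id mm_assoc antitransp_simps antitransp_mm antitransp_Fm sum_negf scal_simps(3))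
  have 2: "(\<Sum>a\<in>?I. \<Sum>b\<in>?I. \<Sum>c\<in>?I. scal (w a b c) (Fm a \<star> (Fm b \<star> (Z \<star> Fm c)))) = L Z"
    by (simp add: L_def)
  have 3: "(\<Sum>a\<in>?I. \<Sum>b\<in>?I. \<Sum>c\<in>?I. scal (w a b c) (Fm a \<star> (Fm c \<star> (Z \<star> Fm b)))) = L Z"
  proof -
    have "(\<Sum>b\<in>?I. \<Sum>c\<in>?I. scal (w a b c) (Fm a \<star> (Fm c \<star> (Z \<star> Fm b)))) =
      (\<Sum>b\<in>?I. \<Sum>c\<in>?I. scal (w a b c) (Fm a \<star> (Fm b \<star> (Z \<star> Fm c))))" for a
      by (subst sum.swap) (simp only: w')
    then show ?thesis by (simp add: L_def)
  qed
  have 4: "(\<Sum>a\<in>?I. \<Sum>b\<in>?I. \<Sum>c\<in>?I. scal (w a b c) (Fm b \<star> (Fm c \<star> (Z \<star> Fm a)))) = L Z"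
    unfolding L_def by (subst sum_swap3) (simp only: w(2)[symmetric])
  have th2: "(\<Sum>a\<in>?I. \<Sum>b\<in>?I. \<Sum>c\<in>?I. scal (w a b c) (Fm c \<star> (Z \<star> (Fm b \<star> Fm a)))) = antitransp (L Z)"
    unfolding 2[symmetric] thsum by (simp add: antitransp_simps antitransp_mm antitransp_Fm Z mm_distribs mm_assoc)
  have th3: "(\<Sum>a\<in>?I. \<Sum>b\<in>?I. \<Sum>c\<in>?I. scal (w a b c) (Fm b \<star> (Z \<star> (Fm c \<star> Fm a)))) = antitransp (L Z)"
    unfolding 3[symmetric] thsum by (simp add: antitransp_simps antitransp_mm antitransp_Fm Z mm_distribs mm_assoc)
  have th4: "(\<Sum>a\<in>?I. \<Sum>b\<in>?I. \<Sum>c\<in>?I. scal (w a b c) (Fm a \<star> (Z \<star> (Fm c \<star> Fm b)))) = antitransp (L Z)"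
    unfolding 4[symmetric] thsum by (simp add: antitransp_simps antitransp_mm antitransp_Fm Z mm_distribs mm_assoc)
  have expand: "scal x (ad_op A (ad_op B (ad_op C Z))) =
      scal x (A \<star> (B \<star> (C \<star> Z))) - scal x (Z \<star> (C \<star> (B \<star> A)))
      - scal x (A \<star> (B \<star> (Z \<star> C))) - scal x (A \<star> (C \<star> (Z \<star> B))) - scal x (B \<star> (C \<star> (Z \<star> A)))
      + scal x (C \<star> (Z \<star> (B \<star> A))) + scal x (B \<star> (Z \<star> (C \<star> A))) + scal x (A \<star> (Z \<star> (C \<star> B)))"
    for x A B C
    by (simp add: ad_op_def mm_distribs mm_assoc scal_simps algebra_simps)
  have three: "scal 3 X = X + X + X" for X :: "'a fmat"
    by (simp add: fun_eq_iff scal_def)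
  show ?thesis
    unfolding expand sum.distrib sum_subtractf 1 2 3 4 8 th2 th3 th4 three
    by (simp add: algebra_simps)
qed

end

lemma scal_zero: "scal c 0 = 0"
  by (simp add: fun_eq_iff scal_def)

section \<open>Cofactors, the resolvent and its derivatives\<close>

context square_matrices
begin

text \<open>The transpose is built in so that the matrix of cofactors itself is the inverse up to
  the determinant.\<close>

definition transp_mat :: "'r::comm_ring_1 mat \<Rightarrow> 'r fmat"
  where "transp_mat M = (\<lambda>i j. if i < n \<and> j < n then M $$ (j, i) else 0)"

definition cofactors :: "'r::comm_ring_1 mat \<Rightarrow> 'r fmat"
  where "cofactors M = (\<lambda>i j. if i < n \<and> j < n then cofactor M i j else 0)"

lemma supported_transp_mat [simp]: "supported (transp_mat M)"
  by (rule supportedI) (simp_all add: transp_mat_def)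

lemma supported_cofactors [simp]: "supported (cofactors M)"
  by (rule supportedI) (simp_all add: cofactors_def)

lemma transp_mat_cofactors:
  assumes M: "M \<in> carrier_mat n n"
  shows "transp_mat M \<star> cofactors M = scal (det M) Id"
    "cofactors M \<star> transp_mat M = scal (det M) Id"
proof -
  have entry: "(A * B) $$ (i, j) = (\<Sum>k<n. A $$ (i, k) * B $$ (k, j))"
    if "A \<in> carrier_mat n n" "B \<in> carrier_mat n n" "i < n" "j < n" for A B :: "'a mat" and i j
    using that by (simp add: scalar_prod_def atLeast0LessThan)
  have adj: "adj_mat M $$ (i, j) = cofactor M j i" if "i < n" "j < n" for i j
    using that M by (simp add: adj_mat_def)
  show "transp_mat M \<star> cofactors M = scal (det M) Id"
  proof (rule supported_eqI)
    fix i j assume ij: "i < n" "j < n"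
    have "(transp_mat M \<star> cofactors M) i j = (adj_mat M * M) $$ (j, i)"
      using ij by (simp add: entry[OF adj_mat(1)[OF M] M] adj mm_apply transp_mat_def cofactors_def
          mult.commute)
    then show "(transp_mat M \<star> cofactors M) i j = scal (det M) Id i j"
      using ij by (auto simp: adj_mat[OF M] scal_def Id_def)
  qed simp_all
  show "cofactors M \<star> transp_mat M = scal (det M) Id"
  proof (rule supported_eqI)
    fix i j assume ij: "i < n" "j < n"
    have "(cofactors M \<star> transp_mat M) i j = (M * adj_mat M) $$ (j, i)"
      using ij by (simp add: entry[OF M adj_mat(1)[OF M]] adj mm_apply transp_mat_def cofactors_def
          mult.commute)
    then show "(cofactors M \<star> transp_mat M) i j = scal (det M) Id i j"
      using ij by (auto simp: adj_mat[OF M] scal_def Id_def)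
  qed simp_all
qed

text \<open>Differentiating \<open>det M * P = 1\<close> gives
  \<open>D P = - (P * P * D (det M))\<close>. Jacobi's formula writes the last factor as a trace
  with the cofactors, and one P turns these into the inverse.\<close>

lemma derivation_inverse_det:
  assumes "derivation D" and M: "M \<in> carrier_mat n n" and P: "det M * P = 1"
  shows "D P = - P * tr (scal P (cofactors M) \<star> map_entries D (transp_mat M))"
proof -
  interpret derivation D by fact
  have "tr (cofactors M \<star> map_entries D (transp_mat M)) =
      (\<Sum>i<n. \<Sum>j<n. D (M $$ (i, j)) * cofactor M i j)"
    by (simp add: tr_def mm_apply cofactors_def map_entries_def transp_mat_def mult.commute)
  also have "\<dots> = D (det M)" by (rule det[OF M, symmetric])
  finally have T: "tr (cofactors M \<star> map_entries D (transp_mat M)) = D (det M)" .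
  have "D (det M) * P + det M * D P = 0"
    using P mult one by metis
  then have "P * (D (det M) * P + det M * D P) = 0"
    by simp
  then have "(det M * P) * D P + P * P * D (det M) = 0"
    by (simp add: algebra_simps)
  then have "D P = - (P * P * D (det M))"
    unfolding P by (simp add: eq_neg_iff_add_eq_0)
  then show ?thesis
    by (simp add: mm_distribs tr_simps T algebra_simps)
qed

text \<open>Differentiate H N = Id and multiply by H on the right.\<close>

lemma derivation_inverse:
  assumes "derivation D" and H: "supported H" and N: "N \<star> H = Id" "H \<star> N = Id"
  shows "map_entries D H = - (H \<star> (map_entries D N \<star> H))"
proof -
  have "(map_entries D H \<star> N + H \<star> map_entries D N) \<star> H = 0"
    unfolding map_entries_derivation(1)[OF assms(1), symmetric] N
      map_entries_derivation(6)[OF assms(1)] by (simp add: mm_distribs)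
  then show ?thesis
    using map_entries_derivation(8)[OF assms(1) H]
    by (simp add: mm_distribs mm_assoc N mm_Id eq_neg_iff_add_eq_0)
qed

text \<open>\<open>antitransp H = (1 + qY)\<inverse>\<close>, and \<open>(1 - qY) + (1 + qY) = 2\<close> gives \<open>H + antitransp H = 2 H (antitransp H)\<close>.\<close>

lemma resolvent_relations:
  fixes H Y :: "'r::comm_ring_1 fmat"
  assumes Y: "supported Y" "antitransp Y = - Y" and H: "supported H"
    and inv: "(Id - scal q Y) \<star> H = Id" "H \<star> (Id - scal q Y) = Id"
    and no_2_torsion: "\<forall>x :: 'r. 2 * x = 0 \<longrightarrow> x = 0"
  defines "W \<equiv> H \<star> antitransp H"
  shows "antitransp H = scal 2 W - H" "antitransp W = W" "W \<star> H = H \<star> W" "H \<star> H = scal 2 (H \<star> W) - W"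
proof -
  let ?K = "scal q Y" and ?H' = "antitransp H"
  have KH: "?K \<star> H = H - Id" "H \<star> ?K = H - Id"
    using inv H by (simp_all add: mm_distribs mm_Id algebra_simps)
  have antitransp_K: "antitransp ?K = - ?K" by (simp add: antitransp_simps Y scal_simps)
  have KH': "?K \<star> ?H' = Id - ?H'" "?H' \<star> ?K = Id - ?H'"
    using arg_cong[OF KH(1), of antitransp] arg_cong[OF KH(2), of antitransp]
    by (simp_all only: antitransp_mm antitransp_simps mm_distribs Y(2) scal_simps) (simp_all add: algebra_simps)
  have two: "scal 2 X = X + X" for X :: "'r fmat"
    by (simp add: fun_eq_iff scal_def)
  have "(H \<star> ?K) \<star> ?H' = H \<star> (?K \<star> ?H')" by (rule mm_assoc)
  then have 1: "scal 2 (H \<star> ?H') = H + ?H'"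
    unfolding KH KH' by (simp add: mm_distribs mm_Id H two algebra_simps)
  \<comment> \<open>The opposite order yields the same right-hand side, so H and H' commute once 2
    is cancelled.\<close>
  have "(?H' \<star> ?K) \<star> H = ?H' \<star> (?K \<star> H)" by (rule mm_assoc)
  then have 2: "scal 2 (?H' \<star> H) = H + ?H'"
    unfolding KH KH' by (simp add: mm_distribs mm_Id H two algebra_simps)
  have comm: "?H' \<star> H = H \<star> ?H'"
  proof (intro ext)
    fix i j
    have "2 * ((?H' \<star> H) i j - (H \<star> ?H') i j) = 0"
      using 1 2 by (simp add: fun_eq_iff scal_def algebra_simps)
    from no_2_torsion[rule_format, OF this] show "(?H' \<star> H) i j = (H \<star> ?H') i j" by simp
  qed
  show W1: "antitransp H = scal 2 W - H" using 1 by (simp add: W_def)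
  show "antitransp W = W" by (simp add: W_def antitransp_mm antitransp_antitransp[OF H])
  show "W \<star> H = H \<star> W" by (simp add: W_def mm_assoc comm)
  have "H \<star> ?H' = scal 2 (H \<star> W) - H \<star> H"
    by (subst W1) (simp add: mm_distribs)
  then show "H \<star> H = scal 2 (H \<star> W) - W"
    by (simp add: W_def algebra_simps)
qed

text \<open>The derivations enter only through their values on q, Y and Z, so the ring stays
  abstract. The right-hand side is q^2 (n + E)(n + E - 1) applied to the entry of f.\<close>

theorem resolvent_identity:
  fixes q P :: "'r::comm_ring_1" and D :: "nat \<times> nat \<Rightarrow> 'r \<Rightarrow> 'r"
  assumes no_2_torsion: "\<forall>x :: 'r. 2 * x = 0 \<longrightarrow> x = 0"
    and D: "\<And>a. derivation (D a)" "\<And>a. D a q = 0"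
    and E: "derivation E" "E q = q"
    and Y: "supported Y" "antitransp Y = - Y"
    and D_Y: "\<And>a. a \<in> so_idx n \<Longrightarrow> map_entries (D a) Y = Ft a" and E_Y: "map_entries E Y = 0"
    and M: "M \<in> carrier_mat n n" "transp_mat M = Id - scal q Y" and P: "det M * P = 1"
    and Z: "supported Z" "antitransp Z = - Z" "map_entries E Z = 0"
  defines "f \<equiv> (\<Sum>a\<in>so_idx n. scal (D a P) (ad_op (Fm a) Z))"
  shows "(\<Sum>a\<in>so_idx n. \<Sum>b\<in>so_idx n. \<Sum>c\<in>so_idx n.
      scal (D c (D b (D a P))) (ad_op (Fm a) (ad_op (Fm b) (ad_op (Fm c) Z)))) i j =
    q\<^sup>2 * (of_nat n * (of_nat n * f i j - f i j + E (f i j))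
      + E (of_nat n * f i j - f i j + E (f i j)))"
proof -
  interpret E: derivation E by fact
  let ?I = "so_idx n"
  define H where "H = scal P (cofactors M)"
  let ?H' = "antitransp H"
  have H: "supported H" by (simp add: H_def)
  have inv: "(Id - scal q Y) \<star> H = Id" "H \<star> (Id - scal q Y) = Id"
    using transp_mat_cofactors[OF M(1)] P
    by (simp_all add: M(2)[symmetric] H_def mm_distribs scal_simps mult.commute)
  note rel = resolvent_relations[OF Y H inv no_2_torsion]
  have W: "supported (H \<star> ?H')" by simp
  have N: "map_entries d (Id - scal q Y) = - scal (d q) Y - scal q (map_entries d Y)"
    if "derivation d" for d
    by (simp add: map_entries_derivation[OF that] algebra_simps)
  \<comment> \<open>The derivative of Id - qY in the direction a is - q F_a^t.\<close>
  have D_H: "map_entries (D a) H = scal q (H \<star> (Ft a \<star> H))" if "a \<in> ?I" for a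
    using derivation_inverse[OF D(1) H inv, of a] that
    by (simp add: N[OF D(1)] D(2) D_Y mm_distribs scal_simps)
  have D_P: "D a P = q * P * tr (H \<star> Ft a)" if "a \<in> ?I" for a
    using derivation_inverse_det[OF D(1) M(1) P, of a] that
    by (simp add: M(2) N[OF D(1)] D(2) D_Y mm_distribs scal_simps tr_simps H_def[symmetric])
  have Ft_const: "map_entries d (Ft b) = 0" if "derivation d" for d :: "'r \<Rightarrow> 'r" and b
  proof -
    interpret derivation d by fact
    have "d (if R then (if P then 1 else 0) - (if Q then 1 else 0) else 0) = 0" for P Q R
      by (simp add: zero one diff)
    then show ?thesis
      unfolding fun_eq_iff map_entries_def Ft_def transp_def Fm_def zero_fun_apply by blast
  qed
  have HK: "H \<star> scal q Y = H - Id"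
    using inv H by (simp add: mm_distribs mm_Id algebra_simps)
  have HKH: "H \<star> (scal q Y \<star> H) = H \<star> H - H"
    unfolding mm_assoc[symmetric] HK by (simp add: mm_distribs mm_Id H)
  \<comment> \<open>Here the derivative of Id - qY is - qY, and H (qY) H collapses to H^2 -
    H.\<close>
  have E_H: "map_entries E H = H \<star> H - H"
    using derivation_inverse[OF E(1) H inv] HKH
    by (simp add: N[OF E(1)] E(2) E_Y mm_distribs scal_simps scal_zero)
  have E_P: "E P = P * (tr H - of_nat n)"
  proof -
    have "tr (H \<star> scal q Y) = tr H - of_nat n"
      unfolding HK by (simp add: tr_simps) (simp add: tr_def Id_def)
    then have "q * tr (H \<star> Y) = tr H - of_nat n"
      by (simp add: mm_distribs tr_simps)
    moreover have "E P = P * (q * tr (H \<star> Y))"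
      using derivation_inverse_det[OF E(1) M(1) P]
      by (simp add: M(2) N[OF E(1)] E(2) E_Y mm_distribs scal_simps scal_zero tr_simps
          H_def[symmetric])
    ultimately show ?thesis by simp
  qed
  have D_tr: "D b (tr (H \<star> X)) = q * tr (H \<star> (Ft b \<star> (H \<star> X))) + tr (H \<star> map_entries (D b) X)"
    if "b \<in> ?I" for b X
    by (simp add: map_entries_derivation[OF D(1)] D_H[OF that] tr_simps mm_distribs mm_assoc)
  have D3: "D c (D b (D a P)) = q ^ 3 * P * third_coeff H a b c"
    if "a \<in> ?I" "b \<in> ?I" "c \<in> ?I" for a b c
  proof -
    interpret Db: derivation "D b" by (rule D)
    interpret Dc: derivation "D c" by (rule D)
    have 2: "D b (D a P) = q\<^sup>2 * P * (tr (H \<star> Ft a) * tr (H \<star> Ft b) + tr (H \<star> (Ft b \<star> (H \<star> Ft a))))"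
      using that by (simp add: D_P Db.mult D(2) D_tr Ft_const[OF D(1)] mm_distribs tr_simps
          power2_eq_square algebra_simps)
    \<comment> \<open>Traces arising in another cyclic order are brought to the order used in
      \<open>third_coeff\<close>.\<close>
    have cyc: "tr (H \<star> (Ft c \<star> (H \<star> Ft a))) = tr (H \<star> (Ft a \<star> (H \<star> Ft c)))"
      "tr (H \<star> (Ft c \<star> (H \<star> Ft b))) = tr (H \<star> (Ft b \<star> (H \<star> Ft c)))"
      "tr (H \<star> (Ft b \<star> (H \<star> Ft a))) = tr (H \<star> (Ft a \<star> (H \<star> Ft b)))"
      "tr (H \<star> (Ft c \<star> (H \<star> (Ft b \<star> (H \<star> Ft a))))) = tr (H \<star> (Ft b \<star> (H \<star> (Ft a \<star> (H \<star> Ft c)))))"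
      "tr (H \<star> (Ft b \<star> (H \<star> (Ft c \<star> (H \<star> Ft a))))) = tr (H \<star> (Ft a \<star> (H \<star> (Ft b \<star> (H \<star> Ft c)))))"
      "tr (H \<star> (Ft a \<star> (H \<star> (Ft c \<star> (H \<star> Ft b))))) = tr (H \<star> (Ft b \<star> (H \<star> (Ft a \<star> (H \<star> Ft c)))))"
      "tr (H \<star> (Ft c \<star> (H \<star> (Ft a \<star> (H \<star> Ft b))))) = tr (H \<star> (Ft a \<star> (H \<star> (Ft b \<star> (H \<star> Ft c)))))"
      using tr_mm_commute[of "H \<star> Ft c" "H \<star> Ft a"] tr_mm_commute[of "H \<star> Ft c" "H \<star> Ft b"]
        tr_mm_commute[of "H \<star> Ft b" "H \<star> Ft a"]
        tr_mm_commute[of "H \<star> Ft c" "H \<star> (Ft b \<star> (H \<star> Ft a))"]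
        tr_mm_commute[of "H \<star> (Ft b \<star> (H \<star> Ft c))" "H \<star> Ft a"]
        tr_mm_commute[of "H \<star> (Ft a \<star> (H \<star> Ft c))" "H \<star> Ft b"]
        tr_mm_commute[of "H \<star> Ft c" "H \<star> (Ft a \<star> (H \<star> Ft b))"]
      by (simp_all only: mm_assoc)
    have "D c (q\<^sup>2) = 0" by (simp add: power2_eq_square Dc.mult D(2))
    then show ?thesis
      unfolding 2 using that by (simp add: Dc.mult Dc.add D_P D_tr Ft_const[OF D(1)] map_entries_derivation[OF D(1)]
          D_H D(2) mm_distribs mm_assoc tr_simps cyc third_coeff_def power2_eq_square power3_eq_cube algebra_simps)
  qed
  have skew: "antitransp (word_sum H Id) = - word_sum H Id"
    unfolding word_sum_Id[OF H W rel no_2_torsion]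
    by (simp add: antitransp_simps antitransp_mm antitransp_antitransp[OF H] mm_assoc scal_simps algebra_simps)
  let ?S1 = "H - ?H'" and ?S2 = "H \<star> H - ?H' \<star> ?H'" and ?S3 = "H \<star> (H \<star> H) - ?H' \<star> (?H' \<star> ?H')"
  define T where "T = tr H"
  define T2 where "T2 = tr (H \<star> H)"
  define x1 where "x1 = ad_op ?S1 Z i j"
  define x2 where "x2 = ad_op ?S2 Z i j"
  define x3 where "x3 = ad_op ?S3 Z i j"
  have L: "(\<Sum>a\<in>?I. \<Sum>b\<in>?I. \<Sum>c\<in>?I.
      scal (D c (D b (D a P))) (ad_op (Fm a) (ad_op (Fm b) (ad_op (Fm c) Z)))) i j =
    q ^ 3 * P * ((T\<^sup>2 + T2 - 2 * T) * x1 + (2 * T - 2) * x2 + 2 * x3)"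
  proof -
    have e1: "(\<Sum>a\<in>?I. \<Sum>b\<in>?I. \<Sum>c\<in>?I.
        scal (D c (D b (D a P))) (ad_op (Fm a) (ad_op (Fm b) (ad_op (Fm c) Z)))) =
      scal (q ^ 3 * P) (ad_op (word_sum H Id) Z)"
    proof -
      have "(\<Sum>a\<in>?I. \<Sum>b\<in>?I. \<Sum>c\<in>?I.
          scal (D c (D b (D a P))) (ad_op (Fm a) (ad_op (Fm b) (ad_op (Fm c) Z)))) =
        (\<Sum>a\<in>?I. \<Sum>b\<in>?I. \<Sum>c\<in>?I. scal (q ^ 3 * P) (scal (third_coeff H a b c)
          (ad_op (Fm a) (ad_op (Fm b) (ad_op (Fm c) Z)))))"
        by (intro sum.cong refl) (simp add: D3 scal_simps)
      also have "\<dots> = scal (q ^ 3 * P) (\<Sum>a\<in>?I. \<Sum>b\<in>?I. \<Sum>c\<in>?I. scal (third_coeff H a b c)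
          (ad_op (Fm a) (ad_op (Fm b) (ad_op (Fm c) Z))))"
        by (simp only: scal_sum)
      also have "(\<Sum>a\<in>?I. \<Sum>b\<in>?I. \<Sum>c\<in>?I. scal (third_coeff H a b c)
          (ad_op (Fm a) (ad_op (Fm b) (ad_op (Fm c) Z)))) = ad_op (word_sum H Id) Z"
        \<comment> \<open>Since \<open>word_sum H Z\<close> is fixed by \<open>antitransp\<close>,
          the terms with Z inside cancel; since \<open>word_sum H Id\<close> changes sign, the two
          outer terms form a commutator.\<close>
        using sum_ad_expand[OF Z(1,2), of "third_coeff H", OF third_coeff_swap third_coeff_rotate]
        unfolding contract_words[OF H] skew word_sum_skew[OF H W rel no_2_torsion Z(1,2)]
        by (simp add: ad_op_def mm_distribs)
      finally show ?thesis .
    qed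
    have e2: "ad_op (word_sum H Id) Z i j = (T\<^sup>2 + T2 - 2 * T) * x1 + (2 * T - 2) * x2 + 2 * x3"
      unfolding word_sum_Id[OF H W rel no_2_torsion] x1_def x2_def x3_def T_def T2_def
      by (simp add: ad_op_def mm_distribs scal_apply algebra_simps)
    show ?thesis by (simp add: e1 scal_apply e2)
  qed
  have E_ad: "E (ad_op A Z i j) = ad_op (map_entries E A) Z i j" for A
  proof -
    have "map_entries E (ad_op A Z) = ad_op (map_entries E A) Z"
      by (simp add: ad_op_def map_entries_derivation[OF E(1)] Z(3) mm_distribs)
    then show ?thesis by (simp add: map_entries_def fun_eq_iff)
  qed
  have E_x1: "E x1 = x2 - x1"
    unfolding x1_def x2_def E_ad
    by (simp add: map_entries_derivation[OF E(1)] E_H antitransp_simps antitransp_mm ad_op_def mm_distribs algebra_simps)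
  have E_x2: "E x2 = 2 * x3 - 2 * x2"
  proof -
    have "map_entries E ?S2 = (?S3 + ?S3) - (?S2 + ?S2)"
      by (simp add: map_entries_derivation[OF E(1)] E_H antitransp_simps antitransp_mm mm_distribs mm_assoc
          algebra_simps)
    note e = this
    have l: "ad_op (A + B) Z = ad_op A Z + ad_op B Z" "ad_op (A - B) Z = ad_op A Z - ad_op B Z"
      for A B by (simp_all add: ad_op_def mm_distribs algebra_simps)
    show ?thesis
      unfolding x2_def x3_def E_ad e unfolding l by (simp add: algebra_simps)
  qed
  have E_T: "E T = T2 - T"
    by (simp add: T_def T2_def map_entries_derivation[OF E(1)] E_H tr_simps)
  have f: "f i j = q * P * x1"
  proof -
    have "f = (\<Sum>a\<in>?I. scal ((q * P) * tr (H \<star> Ft a)) (ad_op (Fm a) Z))"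
      unfolding f_def by (intro sum.cong refl) (simp add: D_P)
    also have "\<dots> = scal (q * P) (ad_op ?S1 Z)"
      by (rule contract_tr_op[where \<phi> = "\<lambda>A. ad_op A Z"])
        (simp_all add: H linear_op_def ad_op_def mm_distribs algebra_simps scal_simps)
    finally show ?thesis by (simp add: scal_apply x1_def)
  qed
  \<comment> \<open>This applies n + E - 1 to f, the n cancelling against the -n in
    \<open>E_P\<close>; \<open>h\<close> then applies n + E to the result.\<close>
  have g: "of_nat n * f i j - f i j + E (f i j) = q * P * ((T - 1) * x1 + x2)"
    unfolding f by (simp add: E.mult E(2) E_P E_x1 T_def algebra_simps)
  have h: "of_nat n * (q * P * ((T - 1) * x1 + x2)) + E (q * P * ((T - 1) * x1 + x2)) =
      q * P * ((T\<^sup>2 + T2 - 2 * T) * x1 + (2 * T - 2) * x2 + 2 * x3)"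
    by (simp add: E.mult E.add E.diff E.one E(2) E_P[folded T_def] E_x1 E_x2 E_T power2_eq_square algebra_simps)
  show ?thesis
    unfolding g L h by (simp add: power2_eq_square power3_eq_cube algebra_simps)
qed

end

subsection \<open>Partial derivatives in the symmetric algebra\<close>

text \<open>For a letter a outside M the difference \<open>M - {#a#}\<close> is M itself, but then
  the factor \<open>count M a\<close> is 0.\<close>

definition pd :: "nat \<times> nat \<Rightarrow> 'a::comm_ring_1 sym_alg \<Rightarrow> 'a sym_alg"
  where "pd a s = (\<Sum>M\<in>Poly_Mapping.keys s.
    Poly_Mapping.single (M - {#a#}) (of_nat (count M a) * Poly_Mapping.lookup s M))"

lemma pd_add: "pd a (s + t) = pd a s + pd a t"
  unfolding pd_def by (rule setsum_keys_plus_distrib) (auto simp: single_add ring_distribs)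

lemma pd_single:
  "pd a (Poly_Mapping.single M c) = Poly_Mapping.single (M - {#a#}) (of_nat (count M a) * c)"
  unfolding pd_def
  by (rule sum_keys_single[where f = "\<lambda>M c. Poly_Mapping.single (M - {#a#}) (of_nat (count M a) * c)"]) simp

lemma pd_0: "pd a 0 = 0"
  by (simp add: pd_def)

lemma pd_sum: "pd a (\<Sum>x\<in>X. f x) = (\<Sum>x\<in>X. pd a (f x))"
  by (induction X rule: infinite_finite_induct) (simp_all add: pd_0 pd_add)

lemma pd_mult_single:
  "pd a (Poly_Mapping.single M c * Poly_Mapping.single N d) =
    pd a (Poly_Mapping.single M c) * Poly_Mapping.single N d
    + Poly_Mapping.single M c * pd a (Poly_Mapping.single N d)"
proof -
  have "Poly_Mapping.single (M - {#a#} + N) (of_nat (count M a) * c * d) =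
      Poly_Mapping.single (M + N - {#a#}) (of_nat (count M a) * c * d)"
    by (cases "a \<in># M") (simp_all add: not_in_iff)
  moreover have "Poly_Mapping.single (M + (N - {#a#})) (c * (of_nat (count N a) * d)) =
      Poly_Mapping.single (M + N - {#a#}) (of_nat (count N a) * c * d)"
    by (cases "a \<in># N") (simp_all add: not_in_iff mult_ac)
  ultimately show ?thesis
    by (simp add: pd_single mult_single algebra_simps flip: single_add)
qed

lemma derivation_pd: "derivation (pd a)"
proof
  fix s t :: "'a sym_alg"
  show "pd a (s + t) = pd a s + pd a t" by (rule pd_add)
  have "pd a ((\<Sum>M\<in>Poly_Mapping.keys s. Poly_Mapping.single M (Poly_Mapping.lookup s M))
      * (\<Sum>N\<in>Poly_Mapping.keys t. Poly_Mapping.single N (Poly_Mapping.lookup t N))) =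
    pd a (\<Sum>M\<in>Poly_Mapping.keys s. Poly_Mapping.single M (Poly_Mapping.lookup s M))
      * (\<Sum>N\<in>Poly_Mapping.keys t. Poly_Mapping.single N (Poly_Mapping.lookup t N))
    + (\<Sum>M\<in>Poly_Mapping.keys s. Poly_Mapping.single M (Poly_Mapping.lookup s M))
      * pd a (\<Sum>N\<in>Poly_Mapping.keys t. Poly_Mapping.single N (Poly_Mapping.lookup t N))"
    by (simp only: pd_sum sum_product pd_mult_single sum.distrib)
  then show "pd a (s * t) = pd a s * t + s * pd a t"
    by (simp only: sum_single_keys)
qed

definition fpd :: "nat \<times> nat \<Rightarrow> 'a::comm_ring_1 sym_alg fps \<Rightarrow> 'a sym_alg fps"
  where "fpd a f = Abs_fps (\<lambda>k. pd a (fps_nth f k))"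

lemma fpd_nth: "fps_nth (fpd a f) k = pd a (fps_nth f k)"
  by (simp add: fpd_def)

lemma derivation_fpd: "derivation (fpd a)"
proof
  fix f g :: "'a sym_alg fps"
  interpret derivation "pd a" by (rule derivation_pd)
  show "fpd a (f + g) = fpd a f + fpd a g"
    by (rule fps_ext) (simp add: fpd_nth add)
  show "fpd a (f * g) = fpd a f * g + f * fpd a g"
    by (rule fps_ext) (simp add: fpd_nth fps_mult_nth sum mult sum.distrib)
qed

lemma fpd_X: "fpd a fps_X = 0"
proof -
  interpret derivation "pd a" by (rule derivation_pd)
  show ?thesis by (rule fps_ext) (simp add: fpd_nth fps_X_def zero one)
qed

definition euler :: "'r::comm_ring_1 fps \<Rightarrow> 'r fps"
  where "euler f = fps_X * fps_deriv f"

lemma derivation_euler: "derivation euler"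
  by unfold_locales (simp_all add: euler_def algebra_simps)

lemma euler_nth: "fps_nth (euler f) k = of_nat k * fps_nth f k"
  by (cases k) (simp_all add: euler_def)

text \<open>Supplies the cancellation of 2 that \<open>resolvent_identity\<close> assumes.\<close>

lemma sym_alg_fps_no_2_torsion: "2 * x = 0 \<Longrightarrow> x = (0 :: 'a::field_char_0 sym_alg fps)"
proof -
  assume "2 * x = 0"
  then have x: "x + x = 0" by (simp only: mult_2)
  have "Poly_Mapping.lookup (fps_nth x k) M = 0" for k M
  proof -
    have "Poly_Mapping.lookup (fps_nth (x + x) k) M = 0"
      unfolding x by simp
    then have "2 * Poly_Mapping.lookup (fps_nth x k) M = 0"
      by (simp only: fps_add_nth lookup_add mult_2)
    then show ?thesis by simp
  qed
  then show "x = 0"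
    by (intro fps_ext poly_mapping_eqI) simp
qed

section \<open>Homogeneity of the invariants\<close>

text \<open>Monomials are also confined to basis letters, so that sums of partial derivatives over
  \<open>so_idx n\<close> see every factor.\<close>

definition homog :: "nat \<Rightarrow> nat \<Rightarrow> 'a::comm_ring_1 sym_alg \<Rightarrow> bool"
  where "homog n d s \<longleftrightarrow> (\<forall>M\<in>Poly_Mapping.keys s. size M = d \<and> set_mset M \<subseteq> so_idx n)"

lemma homog_add: "homog n d s \<Longrightarrow> homog n d t \<Longrightarrow> homog n d (s + t)"
  unfolding homog_def using Poly_Mapping.keys_add[of s t] by blast

lemma homog_0: "homog n d 0"
  by (simp add: homog_def)

lemma homog_1: "homog n 0 1"
  by (simp add: homog_def)

lemma homog_uminus: "homog n d s \<Longrightarrow> homog n d (- s)"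
  by (simp add: homog_def)

lemma homog_sum: "(\<And>x. x \<in> X \<Longrightarrow> homog n d (f x)) \<Longrightarrow> homog n d (\<Sum>x\<in>X. f x)"
  by (induction X rule: infinite_finite_induct) (simp_all add: homog_0 homog_add)

lemma homog_mult: "homog n d s \<Longrightarrow> homog n e t \<Longrightarrow> homog n (d + e) (s * t)"
  unfolding homog_def using keys_mult[of s t] by fastforce

definition graded :: "nat \<Rightarrow> 'a::comm_ring_1 sym_alg fps \<Rightarrow> bool"
  where "graded n f \<longleftrightarrow> (\<forall>d. homog n d (fps_nth f d))"

lemma graded_1: "graded n 1"
  by (simp add: graded_def homog_1 homog_0)

lemma graded_0: "graded n 0"
  by (simp add: graded_def homog_0)

lemma graded_uminus: "graded n f \<Longrightarrow> graded n (- f)"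
  by (simp add: graded_def homog_uminus)

lemma graded_add: "graded n f \<Longrightarrow> graded n g \<Longrightarrow> graded n (f + g)"
  by (simp add: graded_def homog_add)

lemma graded_diff: "graded n f \<Longrightarrow> graded n g \<Longrightarrow> graded n (f - g)"
  using graded_add[of n f "- g"] graded_uminus[of n g] by simp

lemma graded_mult:
  assumes "graded n f" "graded n g"
  shows "graded n (f * g)"
  unfolding graded_def fps_mult_nth
proof (intro allI homog_sum)
  fix d i :: nat assume "i \<in> {0..d}"
  then show "homog n d (fps_nth f i * fps_nth g (d - i))"
    using homog_mult[of n i "fps_nth f i" "d - i" "fps_nth g (d - i)"] assms
    by (simp add: graded_def)
qed

lemma graded_sum: "(\<And>x. x \<in> X \<Longrightarrow> graded n (f x)) \<Longrightarrow> graded n (\<Sum>x\<in>X. f x)"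
  by (induction X rule: infinite_finite_induct) (simp_all add: graded_0 graded_add)

lemma graded_prod: "(\<And>x. x \<in> X \<Longrightarrow> graded n (f x)) \<Longrightarrow> graded n (\<Prod>x\<in>X. f x)"
  by (induction X rule: infinite_finite_induct) (simp_all add: graded_1 graded_mult)

lemma homog_sym_of: "homog n 1 (sym_of n A)"
  unfolding sym_of_def
proof (rule homog_sum)
  fix b assume "b \<in> so_idx n"
  then show "homog n 1 (Poly_Mapping.single {#b#} (A $$ b))"
    by (simp add: homog_def)
qed

text \<open>In each entry of 1 - qX every generator is accompanied by one q, and the determinant is
  a signed sum of products of entries.\<close>

lemma graded_Phi_det: "graded n (Phi_det n :: 'a::comm_ring_1 sym_alg fps)"
proof -
  let ?M = "1\<^sub>m n - fps_X \<cdot>\<^sub>m map_mat fps_const (F_gen n) :: 'a sym_alg fps mat"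
  have M: "?M \<in> carrier_mat n n" by (auto simp: F_gen_def intro!: minus_carrier_mat)
  have entry: "graded n (?M $$ (i, j))" if "i < n" "j < n" for i j
  proof -
    have "graded n (fps_X * fps_const (sym_of n (F_mat n (i, j)) :: 'a sym_alg))"
      unfolding graded_def
    proof
      fix d
      show "homog n d (fps_nth (fps_X * fps_const (sym_of n (F_mat n (i, j)) :: 'a sym_alg)) d)"
        using homog_sym_of[of n "F_mat n (i, j)"]
        by (cases d) (auto simp: homog_0 fps_const_def)
    qed
    moreover have "?M $$ (i, j) =
        (if i = j then 1 else 0) - fps_X * fps_const (sym_of n (F_mat n (i, j)))"
      using that by (simp add: F_gen_def)
    ultimately show ?thesis
      by (simp add: graded_diff graded_0 graded_1)
  qed
  show ?thesis
    unfolding Phi_det_def det_def'[OF M]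
  proof (intro graded_sum graded_mult graded_prod)
    fix p assume "p \<in> {p. p permutes {0..<n}}"
    show "graded n (signof p :: 'a sym_alg fps)"
      by (simp add: sign_def graded_1 graded_uminus)
    fix i assume "i \<in> {0..<n}"
    then show "graded n (?M $$ (i, p i))"
      using \<open>p \<in> _\<close> permutes_in_image[of p "{0..<n}" i] by (intro entry) auto
  qed
qed

text \<open>As the determinant has constant term 1, comparing coefficients in \<open>Phi_gen\<close>
  expresses \<open>Phi n d\<close> by invariants of lower degree times graded coefficients.\<close>

lemma homog_Phi: "homog n d (Phi n d :: 'a::comm_ring_1 sym_alg)"
proof (induction d rule: less_induct)
  case (less d)
  show ?case
  proof (cases d)
    case 0
    have "Phi n 0 = (1 :: 'a sym_alg)"
      by (simp add: Phi_def)
    then show ?thesis by (simp add: 0 homog_1)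
  next
    case (Suc e)
    have "fps_nth (Phi_det n * Abs_fps (Phi n)) d = (0 :: 'a sym_alg)"
      by (simp add: Phi_gen Suc)
    then have "(\<Sum>i = 0..d. fps_nth (Phi_det n) i * Phi n (d - i)) = (0 :: 'a sym_alg)"
      by (simp add: fps_mult_nth)
    then have "Phi n d = - (\<Sum>i = Suc 0..d. fps_nth (Phi_det n) i * (Phi n (d - i) :: 'a sym_alg))"
      by (simp add: sum.atLeast_Suc_atMost Phi_det_0 eq_neg_iff_add_eq_0)
    also have "homog n d \<dots>"
    proof (intro homog_uminus homog_sum)
      fix i assume i: "i \<in> {Suc 0..d}"
      then have "homog n (i + (d - i)) (fps_nth (Phi_det n) i * (Phi n (d - i) :: 'a sym_alg))"
        using less.IH[of "d - i"] graded_Phi_det[where 'a = 'a, of n]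
        by (intro homog_mult) (auto simp: graded_def)
      then show "homog n d (fps_nth (Phi_det n) i * (Phi n (d - i) :: 'a sym_alg))"
        using i by simp
    qed
    finally show ?thesis .
  qed
qed

subsection \<open>Symmetrisation by differential operators\<close>

text \<open>Symmetrisation without normalisation, for an arbitrary function of the word, so that
  letters can be peeled off one at a time.\<close>

definition perm_sum :: "('b list \<Rightarrow> 'c::comm_monoid_add) \<Rightarrow> 'b list \<Rightarrow> 'c"
  where "perm_sum g ys = (\<Sum>\<sigma> | \<sigma> permutes {..<length ys}. g (permute_list \<sigma> ys))"

definition perm_msum :: "('b list \<Rightarrow> 'c::comm_monoid_add) \<Rightarrow> 'b multiset \<Rightarrow> 'c"
  where "perm_msum g M = perm_sum g (SOME ys. mset ys = M)"

lemma perm_sum_mset: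
  assumes "mset xs = mset ys"
  shows "perm_sum g xs = perm_sum g ys"
proof -
  obtain p where p: "p permutes {..<length ys}" "permute_list p ys = xs"
    using mset_eq_permutation[OF assms] .
  have len: "length xs = length ys" using assms by (rule mset_eq_length)
  have "perm_sum g xs = (\<Sum>\<sigma> | \<sigma> permutes {..<length ys}. g (permute_list (p \<circ> \<sigma>) ys))"
    unfolding perm_sum_def len
    by (rule sum.cong) (auto simp: p(2)[symmetric] permute_list_compose)
  also have "\<dots> = perm_sum g ys"
    unfolding perm_sum_def
    using setum_permutations_compose_left[OF p(1), of "\<lambda>\<sigma>. g (permute_list \<sigma> ys)"] by simp
  finally show ?thesis .
qed

lemma perm_msum_mset: "perm_msum g (mset ys) = perm_sum g ys"
  unfolding perm_msum_def by (rule perm_sum_mset) (rule some_mset)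

text \<open>Permutations of the positions after the first are transported along \<open>Suc\<close>
  to permutations of the tail.\<close>

lemma perm_sum_fix_head:
  "(\<Sum>q | q permutes Suc ` {..<length zs}. g (permute_list q (z # zs))) =
    perm_sum (\<lambda>w. g (z # w)) zs"
proof -
  let ?m = "length zs"
  define up where "up q x = (if x \<in> Suc ` {..<?m} then Suc (q (inv_into {..<?m} Suc x)) else x)"
    for q :: "nat \<Rightarrow> nat" and x
  have "bij_betw up {q. q permutes {..<?m}} {q. q permutes Suc ` {..<?m}}"
    unfolding up_def by (rule bij_betw_permutations) (simp add: bij_betw_def)
  then have "(\<Sum>q | q permutes Suc ` {..<?m}. g (permute_list q (z # zs))) =
      (\<Sum>q | q permutes {..<?m}. g (permute_list (up q) (z # zs)))"
    by (rule sum.reindex_bij_betw[symmetric])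
  also have "\<dots> = perm_sum (\<lambda>w. g (z # w)) zs"
    unfolding perm_sum_def
  proof (rule sum.cong[OF refl])
    fix q assume "q \<in> {q. q permutes {..<?m}}"
    then have q: "q permutes {..<?m}" by simp
    have up: "up q 0 = 0" "\<And>i. i < ?m \<Longrightarrow> up q (Suc i) = Suc (q i)"
      by (auto simp: up_def inv_into_f_f)
    have "permute_list (up q) (z # zs) = z # permute_list q zs"
      by (rule nth_equalityI)
        (auto simp: permute_list_def up nth_Cons' less_Suc_eq_0_disj simp del: upt_Suc)
    then show "g (permute_list (up q) (z # zs)) = g (z # permute_list q zs)" by simp
  qed
  finally show ?thesis .
qed

text \<open>Every permutation is uniquely \<open>transpose 0 b \<circ> q\<close> with q fixing 0,
  and b is the position of the letter that comes first.\<close>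

lemma perm_msum_step:
  assumes "M \<noteq> {#}"
  shows "perm_msum g M = (\<Sum>y\<in>#M. perm_msum (\<lambda>w. g (y # w)) (M - {#y#}))"
proof -
  obtain ys where ys: "M = mset ys" using ex_mset by metis
  obtain m where m: "length ys = Suc m" using assms ys by (cases ys) auto
  have S: "{..<Suc m} = insert 0 (Suc ` {..<m})"
    by (rule lessThan_Suc_eq_insert_0)
  have "perm_msum g M = (\<Sum>\<sigma> | \<sigma> permutes insert 0 (Suc ` {..<m}). g (permute_list \<sigma> ys))"
    by (simp add: ys perm_msum_mset perm_sum_def m S)
  also have "\<dots> = (\<Sum>b\<in>{..<Suc m}. \<Sum>q | q permutes Suc ` {..<m}.
      g (permute_list (transpose 0 b \<circ> q) ys))"
    unfolding S by (rule sum_over_permutations_insert) auto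
  also have "\<dots> = (\<Sum>b\<in>{..<Suc m}. perm_msum (\<lambda>w. g (ys ! b # w)) (M - {#ys ! b#}))"
  proof (rule sum.cong[OF refl])
    fix b assume "b \<in> {..<Suc m}"
    then have b: "b < Suc m" by simp
    have t: "transpose 0 b permutes {..<length ys}"
      using b m by (intro permutes_swap_id) auto
    \<comment> \<open>Exchanging 0 and b puts \<open>ys ! b\<close> in front; of the remaining word
      only the multiset matters.\<close>
    let ?zs = "tl (permute_list (transpose 0 b) ys)"
    have len: "length (permute_list (transpose 0 b) ys) = Suc m" by (simp add: m)
    have hd: "permute_list (transpose 0 b) ys = ys ! b # ?zs"
      using len m by (cases "permute_list (transpose 0 b) ys")
        (auto simp: permute_list_def simp del: upt_Suc dest!: arg_cong[of _ _ "\<lambda>xs. xs ! 0"])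
    have mset: "mset ?zs = M - {#ys ! b#}"
    proof -
      have "add_mset (ys ! b) (mset ?zs) = M"
        using mset_permute_list[OF t] unfolding ys by (subst (asm) hd) simp
      then show ?thesis by (metis add_mset_remove_trivial)
    qed
    have lz: "length ?zs = m" using len by simp
    have "(\<Sum>q | q permutes Suc ` {..<m}. g (permute_list (transpose 0 b \<circ> q) ys)) =
        (\<Sum>q | q permutes Suc ` {..<length ?zs}. g (permute_list q (ys ! b # ?zs)))"
    proof (rule sum.cong)
      fix q assume "q \<in> {q. q permutes Suc ` {..<length ?zs}}"
      then have "q permutes {..<length ys}"
        unfolding m S lz by (auto intro: permutes_subset)
      then show "g (permute_list (transpose 0 b \<circ> q) ys) = g (permute_list q (ys ! b # ?zs))"
        by (simp only: permute_list_compose hd[symmetric])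
    qed (simp_all only: lz)
    also have "\<dots> = perm_msum (\<lambda>w. g (ys ! b # w)) (M - {#ys ! b#})"
      unfolding perm_sum_fix_head mset[symmetric] perm_msum_mset ..
    finally show "(\<Sum>q | q permutes Suc ` {..<m}. g (permute_list (transpose 0 b \<circ> q) ys)) =
        perm_msum (\<lambda>w. g (ys ! b # w)) (M - {#ys ! b#})" .
  qed
  also have "\<dots> = sum_list (map (\<lambda>y. perm_msum (\<lambda>w. g (y # w)) (M - {#y#})) ys)"
    by (simp add: sum_list_sum_nth m atLeast0LessThan)
  also have "\<dots> = (\<Sum>y\<in>#M. perm_msum (\<lambda>w. g (y # w)) (M - {#y#}))"
    by (simp add: ys flip: sum_mset_sum_list mset_map)
  finally show ?thesis .
qed

lemma perm_msum_const:
  "perm_msum (\<lambda>w. Poly_Mapping.single (mset w) (c :: 'a::field_char_0)) M =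
    Poly_Mapping.single M (fact (size M) * c)"
proof -
  obtain ys where ys: "M = mset ys" using ex_mset by metis
  have "perm_sum (\<lambda>w. Poly_Mapping.single (mset w) c) ys =
      (\<Sum>\<sigma> | \<sigma> permutes {..<length ys}. Poly_Mapping.single (mset ys) c)"
    unfolding perm_sum_def by (rule sum.cong) auto
  then show ?thesis
    by (simp add: ys perm_msum_mset sum_const_single card_permutations del: sum_constant)
qed

section \<open>The map m as a third-order differential operator\<close>

definition triple_ad :: "nat \<Rightarrow> nat \<times> nat \<Rightarrow> nat \<times> nat \<Rightarrow> nat \<times> nat \<Rightarrow> nat \<times> nat \<Rightarrow> nat \<times> nat \<Rightarrow> 'a::ring_1"
  where "triple_ad n a b c = op_coeff n (ad (F_mat n a) \<circ> ad (F_mat n b) \<circ> ad (F_mat n c))"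

text \<open>Three uses of \<open>perm_msum_step\<close> extract the letters that act by ad. The
  value does not depend on the order of the others, whose permutations contribute
  \<open>fact (size M - 3)\<close>.\<close>

lemma m_map_single:
  assumes "size M \<ge> 3"
  shows "m_map n (Poly_Mapping.single M c) p q =
    (\<Sum>y1\<in>#M. \<Sum>y2\<in>#M - {#y1#}. \<Sum>y3\<in>#M - {#y1#} - {#y2#}.
      Poly_Mapping.single (M - {#y1#} - {#y2#} - {#y3#})
        (fact (size M - 3) / fact (size M) * triple_ad n y1 y2 y3 p q * c))"
proof -
  define g where "g w = Poly_Mapping.single (mset (drop 3 w)) (c / fact (size M) * m_word n w p q)"
    for w :: "(nat \<times> nat) list"
  obtain ys where ys: "M = mset ys" using ex_mset by metis
  have "m_map n (Poly_Mapping.single M c) p q = perm_msum g M"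
    unfolding m_map_def ys symm_single perm_msum_mset
    by (simp add: symm_word_def m_tensor_sum m_tensor_single ten_prod_sum ten_prod_single
        perm_sum_def g_def ys)
  also have "\<dots> = (\<Sum>y1\<in>#M. \<Sum>y2\<in>#M - {#y1#}. \<Sum>y3\<in>#M - {#y1#} - {#y2#}.
      perm_msum (\<lambda>w. g (y1 # y2 # y3 # w)) (M - {#y1#} - {#y2#} - {#y3#}))"
  proof -
    have ne: "N \<noteq> {#}" if "size N > 0" for N :: "(nat \<times> nat) multiset"
      using that by auto
    have size1: "size (M - {#y1#}) > 0" if "y1 \<in># M" for y1
      using assms that by (simp only: size_Diff_singleton)
    have size2: "size (M - {#y1#} - {#y2#}) > 0" if "y1 \<in># M" "y2 \<in># M - {#y1#}" for y1 y2
      using assms that by (simp only: size_Diff_singleton)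
    have "perm_msum g M = (\<Sum>y1\<in>#M. perm_msum (\<lambda>w. g (y1 # w)) (M - {#y1#}))"
      by (rule perm_msum_step, rule ne) (use assms in simp)
    also have "\<dots> = (\<Sum>y1\<in>#M. \<Sum>y2\<in>#M - {#y1#}. perm_msum (\<lambda>w. g (y1 # y2 # w)) (M - {#y1#} - {#y2#}))"
      by (intro arg_cong[of _ _ sum_mset] image_mset_cong perm_msum_step ne, rule size1)
    also have "\<dots> = (\<Sum>y1\<in>#M. \<Sum>y2\<in>#M - {#y1#}. \<Sum>y3\<in>#M - {#y1#} - {#y2#}.
      perm_msum (\<lambda>w. g (y1 # y2 # y3 # w)) (M - {#y1#} - {#y2#} - {#y3#}))"
      by (intro arg_cong[of _ _ sum_mset] image_mset_cong perm_msum_step ne, rule size2)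
    finally show ?thesis .
  qed
  also have "\<dots> = (\<Sum>y1\<in>#M. \<Sum>y2\<in>#M - {#y1#}. \<Sum>y3\<in>#M - {#y1#} - {#y2#}.
      Poly_Mapping.single (M - {#y1#} - {#y2#} - {#y3#})
        (fact (size M - 3) / fact (size M) * triple_ad n y1 y2 y3 p q * c))"
  proof (intro arg_cong[of _ _ sum_mset] image_mset_cong)
    fix y1 y2 y3 assume "y1 \<in># M" "y2 \<in># M - {#y1#}" "y3 \<in># M - {#y1#} - {#y2#}"
    then have size: "size (M - {#y1#} - {#y2#} - {#y3#}) = size M - 3"
      by (simp only: size_Diff_singleton)
    have "g (y1 # y2 # y3 # w) =
        Poly_Mapping.single (mset w) (c / fact (size M) * triple_ad n y1 y2 y3 p q)" for w
      by (simp add: g_def m_word_def triple_ad_def numeral_3_eq_3 numeral_2_eq_2)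
    then show "perm_msum (\<lambda>w. g (y1 # y2 # y3 # w)) (M - {#y1#} - {#y2#} - {#y3#}) =
        Poly_Mapping.single (M - {#y1#} - {#y2#} - {#y3#})
        (fact (size M - 3) / fact (size M) * triple_ad n y1 y2 y3 p q * c)"
      by (simp only: perm_msum_const size) (simp add: mult_ac)
  qed
  finally show ?thesis .
qed

lemma sum_mset_count:
  fixes h :: "'b \<Rightarrow> 'c::comm_semiring_1"
  assumes "finite I" "set_mset M \<subseteq> I"
  shows "(\<Sum>y\<in>#M. h y) = (\<Sum>a\<in>I. of_nat (count M a) * h a)"
  using assms(2)
proof (induction M)
  case (add x M)
  have "(\<Sum>a\<in>I. of_nat (count (add_mset x M) a) * h a) =
      (\<Sum>a\<in>I. (if a = x then h a else 0) + of_nat (count M a) * h a)"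
    by (rule sum.cong) (simp_all add: algebra_simps)
  then show ?case
    using add assms(1) by (simp add: sum.distrib)
qed simp

text \<open>The multiplicity of a letter in M is the factor that its partial derivative produces;
  additivity of F pulls this factor out.\<close>

lemma sum_pd_single:
  fixes F :: "nat \<times> nat \<Rightarrow> 'a::field_char_0 sym_alg \<Rightarrow> 'a sym_alg"
  assumes add: "\<And>a x y. F a (x + y) = F a x + F a y"
    and M: "set_mset M \<subseteq> so_idx n"
  shows "(\<Sum>a\<in>so_idx n. F a (pd a (Poly_Mapping.single M c))) =
    (\<Sum>y\<in>#M. F y (Poly_Mapping.single (M - {#y#}) c))"
proof -
  have F0: "F a 0 = 0" for a using add[of a 0 0] by simp
  have "F a (Poly_Mapping.single N (of_nat k * c)) = of_nat k * F a (Poly_Mapping.single N c)" for a N k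
    by (induction k) (simp_all add: F0 add single_add algebra_simps)
  then show ?thesis
    unfolding sum_mset_count[OF finite_so_idx M] pd_single by simp
qed

lemma m_map_sum: "m_map n (\<Sum>x\<in>X. f x) p q = (\<Sum>x\<in>X. m_map n (f x) p q)"
  by (simp add: m_map_def symm_sum m_tensor_sum ten_prod_sum)

lemma sym_const_mult_single:
  "sym_const k * Poly_Mapping.single M c = Poly_Mapping.single M (k * c)"
  by (simp add: sym_const_def mult_single)

text \<open>On a monomial, \<open>sum_pd_single\<close> turns the three nested sums over letters
  into partial derivatives; linearity does the rest.\<close>

lemma m_map_pd:
  fixes s :: "'a::field_char_0 sym_alg"
  assumes s: "homog n m s" and m: "m \<ge> 3"
  shows "m_map n s p q = (\<Sum>a\<in>so_idx n. \<Sum>b\<in>so_idx n. \<Sum>c\<in>so_idx n.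
    sym_const (fact (m - 3) / fact m * triple_ad n a b c p q) * pd c (pd b (pd a s)))"
proof -
  let ?I = "so_idx n"
  let ?k = "\<lambda>a b c. sym_const (fact (m - 3) / fact m * triple_ad n a b c p q :: 'a)"
  have single: "m_map n (Poly_Mapping.single M x) p q =
      (\<Sum>a\<in>?I. \<Sum>b\<in>?I. \<Sum>c\<in>?I. ?k a b c * pd c (pd b (pd a (Poly_Mapping.single M x))))"
    if M: "size M = m" "set_mset M \<subseteq> ?I" for M x
  proof -
    have sub: "set_mset (M - {#y#}) \<subseteq> ?I" "set_mset (M - {#y#} - {#z#}) \<subseteq> ?I" for y z
      using M(2) by (auto dest: in_diffD)
    have 3: "(\<Sum>c\<in>?I. ?k a b c * pd c (Poly_Mapping.single N x)) =
        (\<Sum>y\<in>#N. ?k a b y * Poly_Mapping.single (N - {#y#}) x)" if "set_mset N \<subseteq> ?I" for a b N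
      using that by (rule sum_pd_single[rotated]) (simp add: algebra_simps)
    have 2: "(\<Sum>b\<in>?I. \<Sum>c\<in>?I. ?k a b c * pd c (pd b (Poly_Mapping.single N x))) =
        (\<Sum>y\<in>#N. \<Sum>c\<in>?I. ?k a y c * pd c (Poly_Mapping.single (N - {#y#}) x))"
      if "set_mset N \<subseteq> ?I" for a N
      using that by (rule sum_pd_single[rotated]) (simp add: algebra_simps pd_add sum.distrib)
    have 1: "(\<Sum>a\<in>?I. \<Sum>b\<in>?I. \<Sum>c\<in>?I. ?k a b c * pd c (pd b (pd a (Poly_Mapping.single M x)))) =
        (\<Sum>y\<in>#M. \<Sum>b\<in>?I. \<Sum>c\<in>?I. ?k y b c * pd c (pd b (Poly_Mapping.single (M - {#y#}) x)))"
      using M(2) by (rule sum_pd_single[rotated]) (simp add: algebra_simps pd_add sum.distrib)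
    show ?thesis
      unfolding 1 2[OF sub(1)] 3[OF sub(2)] sym_const_mult_single
      using m_map_single[of M n x p q] M(1) m by simp
  qed
  have "m_map n (\<Sum>M\<in>Poly_Mapping.keys s. Poly_Mapping.single M (Poly_Mapping.lookup s M)) p q =
      (\<Sum>M\<in>Poly_Mapping.keys s. \<Sum>a\<in>?I. \<Sum>b\<in>?I. \<Sum>c\<in>?I.
        ?k a b c * pd c (pd b (pd a (Poly_Mapping.single M (Poly_Mapping.lookup s M)))))"
    unfolding m_map_sum using s by (intro sum.cong refl single) (auto simp: homog_def)
  also have "\<dots> = (\<Sum>a\<in>?I. \<Sum>b\<in>?I. \<Sum>c\<in>?I. \<Sum>M\<in>Poly_Mapping.keys s.
        ?k a b c * pd c (pd b (pd a (Poly_Mapping.single M (Poly_Mapping.lookup s M)))))"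
    by (subst sum_swap3, intro sum.cong refl, rule sum.swap)
  also have "\<dots> = (\<Sum>a\<in>?I. \<Sum>b\<in>?I. \<Sum>c\<in>?I. ?k a b c * pd c (pd b (pd a
      (\<Sum>M\<in>Poly_Mapping.keys s. Poly_Mapping.single M (Poly_Mapping.lookup s M)))))"
    by (simp only: pd_sum sum_distrib_left)
  finally show ?thesis by (simp only: sum_single_keys)
qed

text \<open>Homogeneity makes the divisor \<open>size M\<close> the constant d.\<close>

lemma ad_incl_pd:
  fixes s :: "'a::field_char_0 sym_alg"
  assumes s: "homog n d s"
  shows "ad_incl n s p q =
    (\<Sum>a\<in>so_idx n. sym_const (op_coeff n (ad (F_mat n a)) p q / of_nat d) * pd a s)"
proof -
  let ?I = "so_idx n"
  let ?k = "\<lambda>a. op_coeff n (ad (F_mat n a)) p q / of_nat d :: 'a"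
  have "ad_incl n s p q = (\<Sum>M\<in>Poly_Mapping.keys s.
      \<Sum>a\<in>?I. sym_const (?k a) * pd a (Poly_Mapping.single M (Poly_Mapping.lookup s M)))"
    unfolding ad_incl_def
  proof (rule sum.cong[OF refl])
    fix M assume "M \<in> Poly_Mapping.keys s"
    then have M: "size M = d" "set_mset M \<subseteq> ?I" using s by (auto simp: homog_def)
    have "(\<Sum>a\<in>?I. sym_const (?k a) * pd a (Poly_Mapping.single M (Poly_Mapping.lookup s M))) =
        (\<Sum>y\<in>#M. sym_const (?k y) * Poly_Mapping.single (M - {#y#}) (Poly_Mapping.lookup s M))"
      using M(2) by (rule sum_pd_single[rotated]) (simp add: algebra_simps)
    note e = this
    show "(\<Sum>y\<in>#M. Poly_Mapping.single (M - {#y#})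
        (Poly_Mapping.lookup s M / of_nat (size M) * op_coeff n (ad (F_mat n y)) p q)) =
      (\<Sum>a\<in>?I. sym_const (?k a) * pd a (Poly_Mapping.single M (Poly_Mapping.lookup s M)))"
      unfolding e sym_const_mult_single M(1) by (simp add: mult_ac)
  qed
  also have "\<dots> = (\<Sum>a\<in>?I. sym_const (?k a) * pd a
      (\<Sum>M\<in>Poly_Mapping.keys s. Poly_Mapping.single M (Poly_Mapping.lookup s M)))"
    by (subst sum.swap) (simp only: pd_sum sum_distrib_left)
  finally show ?thesis by (simp only: sum_single_keys)
qed

subsection \<open>The generating function\<close>

lemma sym_const_add: "sym_const (x + y) = sym_const x + sym_const y"
  by (simp add: sym_const_def single_add)

lemma sym_const_mult: "sym_const (x * y) = sym_const x * sym_const y"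
  by (simp add: sym_const_def mult_single)

lemma sym_const_0: "sym_const 0 = 0"
  by (simp add: sym_const_def)

lemma sym_const_1: "sym_const 1 = 1"
  by (simp add: sym_const_def flip: single_one)

lemma sym_const_uminus: "sym_const (- x) = - sym_const x"
  by (simp add: sym_const_def single_uminus)

lemma sym_const_diff: "sym_const (x - y) = sym_const x - sym_const y"
  using sym_const_add[of x "- y"] by (simp add: sym_const_uminus)

lemma sym_const_of_nat: "sym_const (of_nat m) = of_nat m"
  by (induction m) (simp_all add: sym_const_0 sym_const_1 sym_const_add)

lemma sym_const_sum: "sym_const (\<Sum>x\<in>X. f x) = (\<Sum>x\<in>X. sym_const (f x))"
  by (induction X rule: infinite_finite_induct) (simp_all add: sym_const_0 sym_const_add)

lemma fps_const_sum: "fps_const (\<Sum>x\<in>X. f x) = (\<Sum>x\<in>X. fps_const (f x))"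
  by (induction X rule: infinite_finite_induct) (simp_all flip: fps_const_add)

lemma ad_carrier: "A \<in> carrier_mat n n \<Longrightarrow> B \<in> carrier_mat n n \<Longrightarrow> ad A B \<in> carrier_mat n n"
  unfolding ad_def by (intro minus_carrier_mat mult_carrier_mat)

lemma pd_sym_of:
  assumes "a \<in> so_idx n"
  shows "pd a (sym_of n A) = sym_const (A $$ a)"
proof -
  have "pd a (sym_of n A) = (\<Sum>b\<in>so_idx n. if b = a then sym_const (A $$ b) else 0)"
    unfolding sym_of_def pd_sum pd_single by (rule sum.cong) (simp_all add: sym_const_def)
  then show ?thesis using assms by simp
qed

section \<open>Transfer of matrices and operators to power series over S(g)\<close>

context square_matrices
begin

text \<open>Scalar matrices become constant series, so that entries of ad and derivatives of the
  invariants live in one ring.\<close>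

definition lift_mat :: "'a::comm_ring_1 mat \<Rightarrow> 'a sym_alg fps fmat"
  where "lift_mat A = (\<lambda>i j. if i < n \<and> j < n then fps_const (sym_const (A $$ (i, j))) else 0)"

lemma supported_lift_mat: "supported (lift_mat A)"
  by (rule supportedI) (simp_all add: lift_mat_def)

lemma lift_mat_ad:
  assumes "A \<in> carrier_mat n n" "B \<in> carrier_mat n n"
  shows "lift_mat (ad A B) = ad_op (lift_mat A) (lift_mat B)"
proof (rule supported_eqI)
  have prod: "fps_const (sym_const ((X * Y) $$ (i, j))) = (lift_mat X \<star> lift_mat Y) i j"
    if "X \<in> carrier_mat n n" "Y \<in> carrier_mat n n" "i < n" "j < n" for X Y :: "'a mat" and i j
  proof -
    have "(X * Y) $$ (i, j) = (\<Sum>k<n. X $$ (i, k) * Y $$ (k, j))"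
      using that by (simp add: scalar_prod_def atLeast0LessThan)
    also have "fps_const (sym_const \<dots>) =
        (\<Sum>k<n. fps_const (sym_const (X $$ (i, k))) * fps_const (sym_const (Y $$ (k, j))))"
      by (simp add: sym_const_sum sym_const_mult fps_const_sum)
    finally show ?thesis
      using that by (simp add: mm_apply lift_mat_def)
  qed
  fix i j assume ij: "i < n" "j < n"
  have "lift_mat (ad A B) i j = fps_const (sym_const ((A * B) $$ (i, j) - (B * A) $$ (i, j)))"
    using ij assms by (simp add: lift_mat_def ad_def del: index_mult_mat(1))
  also have "\<dots> = ad_op (lift_mat A) (lift_mat B) i j"
    using prod[OF assms ij] prod[OF assms(2,1) ij]
    by (simp add: sym_const_diff ad_op_def flip: fps_const_sub)
  finally show "lift_mat (ad A B) i j = ad_op (lift_mat A) (lift_mat B) i j" .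
qed (simp_all add: supported_lift_mat ad_op_def)

lemma const_diff_if:
  "fps_const (sym_const ((if P then 1 else 0) - (if Q then 1 else 0))) =
    (if P then 1 else 0) - (if Q then 1 else 0)"
  by (cases P; cases Q; simp add: sym_const_0 sym_const_1 sym_const_uminus flip: fps_const_neg)

lemma lift_mat_F:
  assumes "a \<in> so_idx n"
  shows "lift_mat (F_mat n a) = Fm a"
proof (rule supported_eqI)
  fix i j assume ij: "i < n" "j < n"
  have a: "a \<in> {..<n} \<times> {..<n}"
    using assms so_idx_bounds by (cases a) auto
  show "lift_mat (F_mat n a :: 'a mat) i j = Fm a i j"
    using ij F_mat_coeff[OF a ij, of "1 :: 'a"]
    by (simp only: lift_mat_def Fm_apply const_diff_if mult_1 simp_thms if_True)
qed (simp_all add: supported_lift_mat)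

text \<open>Used with T a composite of maps \<open>ad (F_mat n a)\<close> and T' the same composite
  of maps \<open>ad_op (Fm a)\<close>.\<close>

lemma lift_op_coeff:
  fixes T :: "'a::comm_ring_1 mat \<Rightarrow> 'a mat"
  assumes "p \<in> so_idx n" "q \<in> so_idx n" and T: "\<And>B. B \<in> carrier_mat n n \<Longrightarrow> lift_mat (T B) = T' (lift_mat B)"
  shows "fps_const (sym_const (op_coeff n T p q)) = T' (Fm q) (fst p) (snd p)"
proof -
  have "fst p < n" "snd p < n" using assms(1) so_idx_bounds[of "fst p" "snd p" n] by auto
  then have "lift_mat A (fst p) (snd p) = fps_const (sym_const (A $$ p))" for A :: "'a mat"
    by (simp add: lift_mat_def)
  then have "fps_const (sym_const (op_coeff n T p q)) = lift_mat (T (F_mat n q)) (fst p) (snd p)"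
    using assms(1,2) by (simp add: op_coeff_def)
  also have "\<dots> = T' (Fm q) (fst p) (snd p)"
    by (simp add: T lift_mat_F[OF assms(2)])
  finally show ?thesis .
qed

text \<open>The transpose of the matrix \<open>(F\<^sub>i\<^sub>j)\<close> over the symmetric algebra.\<close>

definition generic :: "'a::comm_ring_1 sym_alg fps fmat"
  where "generic = (\<lambda>i j. if i < n \<and> j < n then fps_const (sym_of n (F_mat n (j, i))) else 0)"

lemma supported_generic: "supported generic"
  by (rule supportedI) (simp_all add: generic_def)

lemma antitransp_generic: "antitransp generic = - (generic :: 'a::comm_ring_1 sym_alg fps fmat)"
proof (rule supported_eqI)
  fix i j assume ij: "i < n" "j < n"
  have "sym_of n (F_mat n (opp n i, opp n j)) = - sym_of n (F_mat n (j, i) :: 'a mat)"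
    unfolding sym_of_def sum_negf[symmetric]
  proof (rule sum.cong[OF refl])
    fix b assume "b \<in> so_idx n"
    then obtain r c where b: "b = (r, c)" "r < n" "c < n" using so_idx_bounds by (cases b) auto
    show "Poly_Mapping.single {#b#} (F_mat n (opp n i, opp n j) $$ b) =
        - Poly_Mapping.single {#b#} (F_mat n (j, i) $$ b :: 'a)"
      unfolding b F_mat_entry[OF opp_less[OF ij(1)] opp_less[OF ij(2)] b(2,3)]
        F_mat_entry[OF ij(2,1) b(2,3)] opp_opp[OF ij(1)] opp_opp[OF ij(2)]
      by (simp only: minus_diff_eq flip: single_uminus)
  qed
  then show "antitransp generic i j = (- generic :: 'a sym_alg fps fmat) i j"
    using ij by (simp add: antitransp_def generic_def opp_less)
qed (simp_all add: supported_generic)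

text \<open>The coefficient of F_ji at the basis element F_a is its entry at a, and this equals the
  entry (j, i) of F_a because the two index pairs enter symmetrically.\<close>

lemma fpd_generic:
  assumes "a \<in> so_idx n"
  shows "map_entries (fpd a) generic = (Ft a :: 'a::comm_ring_1 sym_alg fps fmat)"
proof (rule supported_eqI)
  interpret derivation "fpd a :: 'a sym_alg fps \<Rightarrow> _" by (rule derivation_fpd)
  show "supported (map_entries (fpd a) (generic :: 'a sym_alg fps fmat))"
    by (rule supportedI) (simp_all add: map_entries_def generic_def zero)
  fix i j assume ij: "i < n" "j < n"
  obtain r c where a: "a = (r, c)" "r < n" "c < n"
    using assms so_idx_bounds by (cases a) auto
  have "fpd a (fps_const s) = fps_const (pd a s)" for s :: "'a sym_alg"
    by (rule fps_ext) (simp add: fpd_nth pd_0)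
  then have "map_entries (fpd a) generic i j = fps_const (sym_const (F_mat n (j, i) $$ a :: 'a))"
    using ij assms by (simp add: map_entries_def generic_def pd_sym_of)
  also have "\<dots> = Ft a i j"
    unfolding a F_mat_entry[OF ij(2,1) a(2,3)] const_diff_if Ft_def transp_def Fm_apply[OF ij(2,1)] ..
  finally show "map_entries (fpd a) generic i j = (Ft a :: 'a sym_alg fps fmat) i j" .
qed simp_all

lemma euler_generic: "map_entries euler generic = (0 :: 'a::comm_ring_1 sym_alg fps fmat)"
  by (simp add: map_entries_def generic_def fun_eq_iff euler_def)

lemma euler_Fm: "map_entries euler (Fm a) = (0 :: 'a::comm_ring_1 sym_alg fps fmat)"
proof -
  have "euler (if R then (if P then 1 else 0) - (if Q then 1 else 0) else 0) = (0 :: 'a sym_alg fps)"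
    for P Q R by (simp add: euler_def)
  then show ?thesis
    unfolding fun_eq_iff map_entries_def Fm_def zero_fun_apply by blast
qed

text \<open>This is the coefficient of degree l + 2 in \<open>resolvent_identity\<close> at the
  entry p, with Z = \<open>Fm q\<close> and \<open>fps_X\<close> as the series variable. The Euler
  operator multiplies the coefficient of degree l by l, so (n + E)(n + E - 1) becomes (n + l)(n + l
  - 1).\<close>

lemma triple_ad_Phi:
  "(\<Sum>a\<in>so_idx n. \<Sum>b\<in>so_idx n. \<Sum>c\<in>so_idx n.
      sym_const (triple_ad n a b c p q) * pd c (pd b (pd a (Phi n (l + 2))))) =
    of_nat ((n + l) * (n + l - 1)) *
    (\<Sum>a\<in>so_idx n. sym_const (op_coeff n (ad (F_mat n a)) p q) * pd a (Phi n l :: 'a::field_char_0 sym_alg))"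
proof (cases "p \<in> so_idx n \<and> q \<in> so_idx n")
  case False
  \<comment> \<open>Outside the basis \<open>op_coeff\<close> has the default value 0, so both sides
    vanish.\<close>
  then have "op_coeff n T p q = 0" for T :: "'a mat \<Rightarrow> 'a mat"
    by (auto simp: op_coeff_def)
  then show ?thesis
    by (simp add: triple_ad_def sym_const_0)
next
  case True
  then have p: "p \<in> so_idx n" and q: "q \<in> so_idx n" by auto
  \<comment> \<open>Positivity keeps the natural number n + l - 1 from being truncated.\<close>
  then have n: "n > 0" using so_idx_bounds[of "fst p" "snd p" n] by auto
  let ?I = "so_idx n" and ?i = "fst p" and ?j = "snd p"
  let ?P = "Abs_fps (Phi n) :: 'a sym_alg fps"
  let ?M = "1\<^sub>m n - fps_X \<cdot>\<^sub>m map_mat fps_const (F_gen n) :: 'a sym_alg fps mat"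
  define f where "f = (\<Sum>a\<in>?I. scal (fpd a ?P) (ad_op (Fm a) (Fm q))) ?i ?j"
  have M: "?M \<in> carrier_mat n n" by (auto simp: F_gen_def intro!: minus_carrier_mat)
  have tM: "transp_mat ?M = Id - scal fps_X generic"
  proof (rule supported_eqI)
    fix i j assume "i < n" "j < n"
    then show "transp_mat ?M i j = (Id - scal fps_X generic) i j"
      by (simp add: transp_mat_def Id_def scal_def generic_def F_gen_def)
  qed (simp_all add: supported_generic)
  have P: "det ?M * ?P = 1"
    using Phi_gen[of n] by (simp add: Phi_det_def)
  have E_X: "euler fps_X = (fps_X :: 'a sym_alg fps)" by (simp add: euler_def)
  have id: "(\<Sum>a\<in>?I. \<Sum>b\<in>?I. \<Sum>c\<in>?I. scal (fpd c (fpd b (fpd a ?P)))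
        (ad_op (Fm a) (ad_op (Fm b) (ad_op (Fm c) (Fm q))))) ?i ?j =
      fps_X\<^sup>2 * (of_nat n * (of_nat n * f - f + euler f) + euler (of_nat n * f - f + euler f))"
    unfolding f_def
    by (rule resolvent_identity[where Y = generic and M = ?M])
      (auto simp: sym_alg_fps_no_2_torsion derivation_fpd fpd_X derivation_euler E_X
        supported_generic antitransp_generic fpd_generic euler_generic M tM P antitransp_Fm euler_Fm)
  have coeff3: "ad_op (Fm a) (ad_op (Fm b) (ad_op (Fm c) (Fm q))) ?i ?j =
      fps_const (sym_const (triple_ad n a b c p q :: 'a))"
    if "a \<in> ?I" "b \<in> ?I" "c \<in> ?I" for a b c
    unfolding triple_ad_def
    by (rule lift_op_coeff[OF p q, symmetric]) (simp add: lift_mat_ad ad_carrier lift_mat_F that)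
  have coeff1: "ad_op (Fm a) (Fm q) ?i ?j = fps_const (sym_const (op_coeff n (ad (F_mat n a)) p q :: 'a))"
    if "a \<in> ?I" for a
    by (rule lift_op_coeff[OF p q, symmetric]) (simp add: lift_mat_ad lift_mat_F that)
  have f_nth: "fps_nth f l = (\<Sum>a\<in>?I. sym_const (op_coeff n (ad (F_mat n a)) p q) * pd a (Phi n l))"
    by (simp add: f_def sum_fun_apply scal_apply coeff1 fps_sum_nth fpd_nth mult.commute)
  have "(\<Sum>a\<in>?I. \<Sum>b\<in>?I. \<Sum>c\<in>?I.
      sym_const (triple_ad n a b c p q) * pd c (pd b (pd a (Phi n (l + 2))))) =
    fps_nth ((\<Sum>a\<in>?I. \<Sum>b\<in>?I. \<Sum>c\<in>?I. scal (fpd c (fpd b (fpd a ?P)))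
        (ad_op (Fm a) (ad_op (Fm b) (ad_op (Fm c) (Fm q))))) ?i ?j) (l + 2)"
    by (simp add: sum_fun_apply scal_apply coeff3 fps_sum_nth fpd_nth mult.commute)
  also have "\<dots> = fps_nth (of_nat n * (of_nat n * f - f + euler f)
      + euler (of_nat n * f - f + euler f)) l"
    \<comment> \<open>The factor \<open>fps_X\<^sup>2\<close> moves the coefficient from l + 2 to
      l.\<close>
    unfolding id by (simp add: fps_X_power_mult_nth)
  also have "\<dots> = (of_nat n + of_nat l) * (of_nat n + of_nat l - 1) * fps_nth f l"
    by (simp add: euler_nth) (simp add: algebra_simps)
  also have "(of_nat n + of_nat l) * (of_nat n + of_nat l - 1 :: 'a sym_alg) = of_nat ((n + l) * (n + l - 1))"
    using n by (simp add: of_nat_diff)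
  finally show ?thesis unfolding f_nth .
qed

end

section \<open>The constant R(k) and the conclusion\<close>

text \<open>With m = 2k - 2, twice the bracket in \<open>R_const\<close> is (n + m)(n + m - 1), so
  R(k) is this product divided by 2k(2k - 1). The remaining factor 2k - 2 of (2k)!/(2k - 3)! is the
  divisor on the right.\<close>

lemma R_const_eq:
  assumes "k \<ge> 2"
  shows "fact (2 * k - 3) / fact (2 * k) * of_nat ((n + (2 * k - 2)) * (n + (2 * k - 2) - 1)) =
    (R_const n k / of_nat (2 * k - 2) :: 'a::field_char_0)"
proof -
  \<comment> \<open>Writing k = j + 2 removes the truncated subtractions from the casts.\<close>
  obtain j where k: "k = j + 2" using assms by (metis add.commute le_Suc_ex)
  have f: "fact (2 * k) = (of_nat (2 * k) * of_nat (2 * k - 1) * of_nat (2 * k - 2) * fact (2 * k - 3) :: 'a)"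
    by (simp add: k numeral_eq_Suc algebra_simps)
  have ch: "2 * of_nat (n choose 2) = (of_nat n * (of_nat n - 1) :: 'a)"
  proof -
    have "2 * (n choose 2) = n * (n - 1)"
    proof -
      have "even (n * (n - 1))" by (cases n) auto
      then show ?thesis by (simp only: choose_two dvd_mult_div_cancel)
    qed
    then have "of_nat (2 * (n choose 2)) = (of_nat (n * (n - 1)) :: 'a)" by (rule arg_cong)
    then show ?thesis by (cases n) (simp_all add: algebra_simps)
  qed
  have c: "of_nat (n choose 2) = (of_nat n * (of_nat n - 1) / 2 :: 'a)"
    using ch by (simp add: field_simps)
  have nz: "of_nat j + 2 \<noteq> (0 :: 'a)" "2 * of_nat j + 3 \<noteq> (0 :: 'a)" "of_nat j + 1 \<noteq> (0 :: 'a)"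
    "2 * of_nat j + 4 \<noteq> (0 :: 'a)" "2 * of_nat j + 2 \<noteq> (0 :: 'a)"
  proof -
    have "of_nat (j + 2) \<noteq> (0 :: 'a)" "of_nat (2 * j + 3) \<noteq> (0 :: 'a)" "of_nat (j + 1) \<noteq> (0 :: 'a)"
      "of_nat (2 * j + 4) \<noteq> (0 :: 'a)" "of_nat (2 * j + 2) \<noteq> (0 :: 'a)"
      by (simp_all only: of_nat_eq_0_iff)
    then show "of_nat j + 2 \<noteq> (0 :: 'a)" "2 * of_nat j + 3 \<noteq> (0 :: 'a)" "of_nat j + 1 \<noteq> (0 :: 'a)"
      "2 * of_nat j + 4 \<noteq> (0 :: 'a)" "2 * of_nat j + 2 \<noteq> (0 :: 'a)"
      by (simp_all add: add.commute)
  qed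
  have casts: "of_nat (2 * k) = (2 * of_nat j + 4 :: 'a)" "of_nat (2 * k - 1) = (2 * of_nat j + 3 :: 'a)"
    "of_nat (2 * k - 2) = (2 * of_nat j + 2 :: 'a)"
    by (simp_all add: k)
  have cancel: "F / (x * F) = 1 / x" if "F \<noteq> 0" for F x :: 'a
    using that by simp
  have r: "fact (2 * k - 3) / fact (2 * k) =
      (1 / ((2 * of_nat j + 4) * (2 * of_nat j + 3) * (2 * of_nat j + 2)) :: 'a)"
    unfolding f casts by (rule cancel) (rule fact_nonzero)
  have N: "of_nat ((n + (2 * k - 2)) * (n + (2 * k - 2) - 1)) =
      ((of_nat n + 2 * of_nat j + 2) * (of_nat n + 2 * of_nat j + 1) :: 'a)"
    by (simp add: k algebra_simps)
  have K: "of_nat (2 * k - 2) = (2 * of_nat j + 2 :: 'a)" "of_nat k = (of_nat j + 2 :: 'a)"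
    by (simp_all add: k)
  have m: "2 * (of_nat j + 2) - 1 = (2 * of_nat j + 3 :: 'a)"
    by simp
  show ?thesis
    unfolding r N R_const_def K c m
    using nz by (simp add: divide_simps) (simp add: algebra_simps)
qed

theorem proposition7p5:
  fixes n k :: nat
  assumes "n \<ge> 7" and "k \<ge> 2"
  shows "m_map n (Phi n (2 * k) :: 'a::field_char_0 sym_alg) =
    (\<lambda>a b. sym_const (R_const n k) * ad_incl n (Phi n (2 * k - 2)) a b)"
proof (intro ext)
  fix p q
  let ?I = "so_idx n" and ?l = "2 * k - 2"
  let ?r = "fact (2 * k - 3) / fact (2 * k) :: 'a"
  let ?S = "\<Sum>a\<in>?I. sym_const (op_coeff n (ad (F_mat n a)) p q) * pd a (Phi n ?l :: 'a sym_alg)"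
  have l: "?l + 2 = 2 * k" and m3: "3 \<le> 2 * k" using assms by simp_all
  have "m_map n (Phi n (2 * k) :: 'a sym_alg) p q =
      sym_const ?r * (\<Sum>a\<in>?I. \<Sum>b\<in>?I. \<Sum>c\<in>?I.
        sym_const (triple_ad n a b c p q) * pd c (pd b (pd a (Phi n (2 * k)))))"
    by (simp only: m_map_pd[OF homog_Phi m3] sym_const_mult sum_distrib_left mult.assoc)
  also have "\<dots> = sym_const ?r * (of_nat ((n + ?l) * (n + ?l - 1)) * ?S)"
    by (simp only: square_matrices.triple_ad_Phi[of n p q ?l, unfolded l])
  also have "\<dots> = sym_const (?r * of_nat ((n + ?l) * (n + ?l - 1))) * ?S"
    by (simp only: sym_const_mult sym_const_of_nat mult.assoc)
  also have "\<dots> = sym_const (R_const n k / of_nat ?l) * ?S"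
    by (simp only: R_const_eq[OF assms(2)])
  \<comment> \<open>The divisor 2k - 2 is the degree d in \<open>ad_incl_pd\<close>.\<close>
  also have "\<dots> = sym_const (R_const n k) * ad_incl n (Phi n ?l) p q"
    unfolding ad_incl_pd[OF homog_Phi] divide_inverse
    by (simp add: sym_const_mult sum_distrib_left mult_ac)
  finally show "m_map n (Phi n (2 * k) :: 'a sym_alg) p q =
    sym_const (R_const n k) * ad_incl n (Phi n (2 * k - 2)) p q" .
qed

end
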